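(* Let $\alpha>0$ be a real number. For every $\beta\in[0,1)$ there exists a non-decreasing sequence $\{\varphi(n)\}_{n=1}^\infty$ of positive real numbers such that $$\limsup_{n\to\infty}\frac{\log\log\varphi(n)}{\log n}=\beta \quad\text{and}\quad \dim_H E_{\varphi(n),\alpha}=1.$$
   Context: Every irrational $x\in(0,1)$ has a continued fraction expansion $x=[a_1(x),a_2(x),\dots]$ with positive integer partial quotients $a_j(x)$. Let $s_n(x)=\sum_{j=1}^n a_j(x)$. For a sequence $\{\varphi(n)\}$ of positive reals and $\alpha\ge 0$, $E_{\varphi(n),\alpha}:=\{x\in(0,1)\setminus\mathbb{Q}: \lim_{n\to\infty} s_n(x)/\varphi(n)=\alpha\}$. $\dim_H$ denotes Hausdorff dimension. *)

theory Defs
  imports "HOL-Analysis.Analysis"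
begin

section \<open>Hausdorff dimension\<close>

text \<open>
  The contribution \<open>(diam U)\<^sup>s\<close> of a covering set \<open>U\<close>, with the conventions that the empty set
  contributes 0 and that \<open>0\<^sup>0 = 1\<close>. The case \<open>s = 0\<close> is separate because \<open>0 powr 0 = 0\<close> in HOL.
\<close>

definition diam_powr :: "real \<Rightarrow> 'a::metric_space set \<Rightarrow> ennreal" where
  "diam_powr s U =
     (if U = {} then 0 else if s = 0 then 1 else ennreal (diameter U powr s))"

text \<open>
  Boundedness is required explicitly since the real-valued \<^const>\<open>diameter\<close> is unspecified on
  unbounded sets.
\<close>

definition delta_covers :: "real \<Rightarrow> 'a::metric_space set \<Rightarrow> (nat \<Rightarrow> 'a set) set" where
  "delta_covers \<delta> A =
     {U. A \<subseteq> (\<Union>i. U i) \<and> (\<forall>i. bounded (U i) \<and> diameter (U i) \<le> \<delta>)}"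

definition hausdorff_content :: "real \<Rightarrow> real \<Rightarrow> 'a::metric_space set \<Rightarrow> ennreal" where
  "hausdorff_content s \<delta> A = (INF U \<in> delta_covers \<delta> A. \<Sum>i. diam_powr s (U i))"

definition hausdorff_measure :: "real \<Rightarrow> 'a::metric_space set \<Rightarrow> ennreal" where
  "hausdorff_measure s A = (SUP \<delta> \<in> {0<..}. hausdorff_content s \<delta> A)"

definition hausdorff_dim :: "'a::metric_space set \<Rightarrow> ennreal" where
  "hausdorff_dim A = (INF s \<in> {s. 0 \<le> s \<and> hausdorff_measure s A = 0}. ennreal s)"


section \<open>Continued fractions\<close>

definition gauss_map :: "real \<Rightarrow> real" where
  "gauss_map x = frac (1 / x)"

text \<open>
  Partial quotients \<open>a\<^sub>1(x), a\<^sub>2(x), \<dots>\<close> are indexed from 1. That this algorithm computes the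
  unique expansion \<open>x = [a\<^sub>1(x), a\<^sub>2(x), \<dots>]\<close> with positive integer entries is
  \<open>partial_quotient_expansion\<close> and \<open>partial_quotient_unique\<close> below.
\<close>

definition partial_quotient :: "nat \<Rightarrow> real \<Rightarrow> nat" where
  "partial_quotient j x = nat \<lfloor>1 / (gauss_map ^^ (j - 1)) x\<rfloor>"

definition quotient_sum :: "nat \<Rightarrow> real \<Rightarrow> nat" where
  "quotient_sum n x = (\<Sum>j=1..n. partial_quotient j x)"

definition E_set :: "(nat \<Rightarrow> real) \<Rightarrow> real \<Rightarrow> real set" where
  "E_set \<phi> \<alpha> =
     {x \<in> {0<..<1} - \<rat>. (\<lambda>n. real (quotient_sum n x) / \<phi> n) \<longlonglongrightarrow> \<alpha>}"

fun cfrac :: "nat list \<Rightarrow> real" where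
  "cfrac [] = 0"
| "cfrac (a # as) = 1 / (real a + cfrac as)"

definition is_cfrac_expansion :: "(nat \<Rightarrow> nat) \<Rightarrow> real \<Rightarrow> bool" where
  "is_cfrac_expansion a x \<longleftrightarrow>
     (\<forall>j\<ge>1. a j > 0) \<and> (\<lambda>n. cfrac (map a [1..<Suc n])) \<longlonglongrightarrow> x"

lemma gauss_map_irrational:
  assumes "x \<in> {0<..<1} - \<rat>"
  shows "gauss_map x \<in> {0<..<1} - \<rat>"
proof -
  have "1 / x \<notin> \<rat>"
    using assms Rats_inverse[of "1 / x"] by (auto simp: field_simps)
  then have "frac (1 / x) \<notin> \<rat>"
    by (metis Rats_add Rats_of_int add_diff_cancel_left' diff_add_cancel frac_def)
  moreover have "0 \<noteq> frac (1 / x)"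
    using \<open>frac (1 / x) \<notin> \<rat>\<close> Rats_0 by metis
  ultimately show ?thesis
    using frac_ge_0[of "1 / x"] frac_lt_1[of "1 / x"]
    by (auto simp: gauss_map_def simp del: frac_ge_0)
qed

lemma gauss_map_funpow_irrational:
  assumes "x \<in> {0<..<1} - \<rat>"
  shows "(gauss_map ^^ n) x \<in> {0<..<1} - \<rat>"
  using assms by (induction n) (simp_all add: gauss_map_irrational del: Diff_iff)

lemma partial_quotient_1: "partial_quotient (Suc 0) x = nat \<lfloor>1 / x\<rfloor>"
  by (simp add: partial_quotient_def)

lemma partial_quotient_Suc:
  "j \<ge> 1 \<Longrightarrow> partial_quotient (Suc j) x = partial_quotient j (gauss_map x)"
  by (cases j) (simp_all add: partial_quotient_def funpow_swap1)

lemma floor_recip_pos: "x \<in> {0<..<1} - \<rat> \<Longrightarrow> \<lfloor>1 / x\<rfloor> \<ge> (1 :: int)"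
  for x :: real
  by (simp add: le_floor_iff)

lemma partial_quotient_pos:
  assumes "x \<in> {0<..<1} - \<rat>"
  shows "partial_quotient j x > 0"
  using floor_recip_pos[OF gauss_map_funpow_irrational[OF assms, of "j - 1"]]
  by (simp add: partial_quotient_def)

lemma cfrac_step:
  assumes "x \<in> {0<..<1} - \<rat>"
  shows "x = 1 / (real (partial_quotient (Suc 0) x) + gauss_map x)"
proof -
  have "real (partial_quotient (Suc 0) x) = of_int \<lfloor>1 / x\<rfloor>"
    using floor_recip_pos[OF assms] unfolding partial_quotient_1 by (intro of_nat_nat) linarith
  then show ?thesis
    by (simp add: gauss_map_def frac_def)
qed

lemma cfrac_tail: "map a [1..<Suc (Suc n)] = a 1 # map (\<lambda>j. a (Suc j)) [1..<Suc n]"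
  by (subst upt_conv_Cons) (simp_all add: map_Suc_upt[symmetric] o_def del: upt_Suc)

lemma cfrac_bounds:
  assumes "\<forall>a\<in>set as. a > 0"
  shows "0 \<le> cfrac as \<and> cfrac as \<le> 1"
  using assms
proof (induction as)
  case (Cons a as)
  then have "real a \<ge> 1" "0 \<le> cfrac as" by auto
  then show ?case by (simp add: divide_simps)
qed simp

lemma recip_diff:
  fixes a y z :: real
  assumes "a \<ge> 1" "y \<ge> 0" "z \<ge> 0"
  shows "\<bar>1 / (a + y) - 1 / (a + z)\<bar> = \<bar>y - z\<bar> / ((a + y) * (a + z))"
proof -
  have "1 / (a + y) - 1 / (a + z) = (z - y) / ((a + y) * (a + z))"
    using assms by (simp add: field_simps)
  then show ?thesis
    using assms by (simp add: abs_mult abs_minus_commute)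
qed

lemma recip_diff2:
  fixes a b y z :: real
  assumes "a \<ge> 1" "b \<ge> 1" "y \<ge> 0" "z \<ge> 0"
  shows "\<bar>1 / (a + 1 / (b + y)) - 1 / (a + 1 / (b + z))\<bar> \<le> \<bar>y - z\<bar> / 4"
proof -
  have two: "(a + 1 / (b + w)) * (b + w) \<ge> 2" if "w \<ge> 0" for w
  proof -
    have "(a + 1 / (b + w)) * (b + w) = a * (b + w) + 1"
      using assms that by (simp add: field_simps)
    moreover have "1 * 1 \<le> a * (b + w)"
      using assms that by (intro mult_mono) auto
    ultimately show ?thesis by simp
  qed
  have "\<bar>1 / (a + 1 / (b + y)) - 1 / (a + 1 / (b + z))\<bar>
      = \<bar>y - z\<bar> / (((a + 1 / (b + y)) * (b + y)) * ((a + 1 / (b + z)) * (b + z)))"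
    using assms by (simp add: recip_diff mult_ac)
  also have "\<dots> \<le> \<bar>y - z\<bar> / (2 * 2)"
    using assms two[of y] two[of z]
    by (intro divide_left_mono mult_mono mult_pos_pos add_pos_nonneg) auto
  finally show ?thesis by simp
qed

lemma cfrac_error:
  assumes "x \<in> {0<..<1} - \<rat>"
  shows "\<bar>cfrac (map (\<lambda>j. partial_quotient j x) [1..<Suc n]) - x\<bar> \<le> (1 / 2) ^ (n - 1)"
  using assms
proof (induction n arbitrary: x rule: less_induct)
  case (less n)
  define q where "q = (\<lambda>x n. map (\<lambda>j. partial_quotient j x) [1..<Suc n])"
  have pos: "\<forall>a\<in>set (q y m). a > 0" if "y \<in> {0<..<1} - \<rat>" for y m
    using partial_quotient_pos[OF that] by (auto simp: q_def)
  have step: "q y (Suc m) = partial_quotient 1 y # q (gauss_map y) m" for y m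
    unfolding q_def cfrac_tail by (simp add: partial_quotient_Suc del: upt_Suc)
  show ?case
  proof (cases "n < 2")
    case True
    then have "n - 1 = 0" by simp
    moreover have "\<bar>cfrac (q x n) - x\<bar> \<le> 1"
      using cfrac_bounds[OF pos[OF less.prems, of n]] less.prems by auto
    ultimately show ?thesis by (simp add: q_def del: upt_Suc)
  next
    case False
    then obtain m where n: "n = Suc (Suc m)"
      by (metis One_nat_def Suc_1 less_2_cases_iff not0_implies_Suc)
    let ?y = "gauss_map x" and ?z = "gauss_map (gauss_map x)"
    have y: "?y \<in> {0<..<1} - \<rat>" and z: "?z \<in> {0<..<1} - \<rat>"
      using less.prems gauss_map_irrational by blast+
    let ?a = "real (partial_quotient (Suc 0) x)" and ?b = "real (partial_quotient (Suc 0) ?y)"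
    have ab: "?a \<ge> 1" "?b \<ge> 1"
      using partial_quotient_pos[OF less.prems, of "Suc 0"] partial_quotient_pos[OF y, of "Suc 0"]
      by linarith+
    have x: "x = 1 / (?a + 1 / (?b + ?z))"
      using cfrac_step[OF less.prems] cfrac_step[OF y] by simp
    have c: "cfrac (q x n) = 1 / (?a + 1 / (?b + cfrac (q ?z m)))"
      by (simp add: n step)
    have "\<bar>cfrac (q x n) - x\<bar> \<le> \<bar>cfrac (q ?z m) - ?z\<bar> / 4"
      using recip_diff2[OF ab, of "cfrac (q ?z m)" ?z, folded x] cfrac_bounds[OF pos[OF z]] z
      by (simp add: c)
    also have "\<dots> \<le> (1 / 2) ^ (m - 1) / 4"
      using less.IH[of m ?z] z by (simp add: n q_def del: upt_Suc)
    also have "\<dots> \<le> (1 / 2) ^ (n - 1)"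
      by (cases m) (simp_all add: n)
    finally show ?thesis by (simp add: q_def del: upt_Suc)
  qed
qed

lemma partial_quotient_expansion:
  assumes "x \<in> {0<..<1} - \<rat>"
  shows "is_cfrac_expansion (\<lambda>j. partial_quotient j x) x"
proof -
  have "(\<lambda>n. (1 / 2 :: real) ^ (n - 1)) \<longlonglongrightarrow> 0"
    by (subst filterlim_sequentially_Suc[symmetric]) (simp add: LIMSEQ_realpow_zero)
  then have "(\<lambda>n. cfrac (map (\<lambda>j. partial_quotient j x) [1..<Suc n]) - x) \<longlonglongrightarrow> 0"
    by (rule Lim_null_comparison[rotated]) (use cfrac_error[OF assms] in auto)
  then show ?thesis
    using partial_quotient_pos[OF assms] LIM_zero_cancel
    by (auto simp: is_cfrac_expansion_def simp del: upt_Suc)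
qed

lemma partial_quotient_unique:
  assumes "x \<in> {0<..<1} - \<rat>" "is_cfrac_expansion a x" "j \<ge> 1"
  shows "a j = partial_quotient j x"
  using assms(3,1,2)
proof (induction j arbitrary: a x rule: dec_induct)
  fix a x assume x: "x \<in> {0<..<1} - \<rat>" and a: "is_cfrac_expansion a x"
  define b where "b = (\<lambda>j. a (Suc j))"
  define c where "c = (\<lambda>n. cfrac (map b [1..<Suc n]))"
  have c01: "0 \<le> c n \<and> c n \<le> 1" for n
    unfolding c_def using a
    by (intro cfrac_bounds) (auto simp: b_def is_cfrac_expansion_def simp del: upt_Suc)
  have "(\<lambda>n. 1 / (real (a 1) + c n)) \<longlonglongrightarrow> x"
    using a filterlim_sequentially_Suc[of "\<lambda>n. cfrac (map a [1..<Suc n])" "nhds x"]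
    unfolding is_cfrac_expansion_def cfrac_tail c_def b_def by simp
  then have "(\<lambda>n. 1 / (1 / (real (a 1) + c n)) - real (a 1)) \<longlonglongrightarrow> 1 / x - real (a 1)"
    using x by (intro tendsto_intros) auto
  then have lim: "c \<longlonglongrightarrow> 1 / x - real (a 1)"
    by simp
  have "0 \<le> 1 / x - real (a 1)" "1 / x - real (a 1) \<le> 1"
    using LIMSEQ_le_const[OF lim] LIMSEQ_le_const2[OF lim] c01 by blast+
  moreover have "1 / x - real (a 1) \<noteq> 1"
  proof
    assume "1 / x - real (a 1) = 1"
    then have "x = 1 / (1 + real (a 1))"
      using x by (simp add: field_simps)
    then have "x \<in> \<rat>"
      by (metis Rats_1 Rats_add Rats_divide Rats_of_nat)
    then show False using x by simp
  qed
  ultimately have fl: "\<lfloor>1 / x\<rfloor> = int (a 1)"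
    by (intro floor_unique) auto
  then show a1: "a 1 = partial_quotient 1 x"
    by (simp add: partial_quotient_1)
  have "is_cfrac_expansion b (gauss_map x)"
    using a lim fl
    by (auto simp: is_cfrac_expansion_def b_def c_def gauss_map_def frac_def simp del: upt_Suc)
  moreover fix j assume "1 \<le> j"
    and IH: "\<And>a x. x \<in> {0<..<1} - \<rat> \<Longrightarrow> is_cfrac_expansion a x \<Longrightarrow> a j = partial_quotient j x"
  ultimately show "a (Suc j) = partial_quotient (Suc j) x"
    using IH[OF gauss_map_irrational[OF x]] by (simp add: b_def partial_quotient_Suc)
qed

end

theory Submission
  imports Defs "HOL-Library.Discrete_Functions" "HOL-Real_Asymp.Real_Asymp"
begin

text \<open>
  Let \<open>\<phi>\<close> be constant, equal to \<open>\<Phi>\<^sub>k = exp (2\<^bsup>k\<beta>\<^esup> + k\<^sup>2)\<close>, on each block \<open>2\<^sup>k \<le> n < 2\<^bsup>k+1\<^esup>\<close>. If the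
  partial quotient number \<open>2\<^sup>k\<close> is about \<open>\<alpha> \<Phi>\<^sub>k\<close> for every \<open>k\<close> and all others are at most \<open>M\<close>, the
  last prescribed one dominates \<open>s\<^sub>n\<close>, so \<open>s\<^sub>n / \<phi>(n) \<longlonglongrightarrow> \<alpha>\<close>. To see that these numbers have
  positive \<open>s\<close>-dimensional measure for \<open>s < 1\<close> and suitable \<open>M\<close>, distribute mass among the children
  of a cylinder proportionally to the \<open>s\<close>-th power of their lengths. At a free digit the mass
  decreases faster than \<open>|I|\<^sup>s\<close> by a constant factor \<open>C > 1\<close>; the prescribed digits up to \<open>2\<^sup>k\<close> cost
  a factor \<open>exp (o(2\<^sup>k))\<close>, as \<open>\<beta> < 1\<close>, which this gain pays for.
\<close>

subsection \<open>Hausdorff measure\<close>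

lemma hausdorff_measure_mono: "A \<subseteq> B \<Longrightarrow> hausdorff_measure s A \<le> hausdorff_measure s B"
  unfolding hausdorff_measure_def hausdorff_content_def
  by (intro SUP_mono' INF_superset_mono) (auto simp: delta_covers_def)

text \<open>Covering by \<open>N\<close> intervals of length \<open>1 / N\<close> costs
  \<open>N powr (1 - s)\<close>, which tends to 0 for \<open>s > 1\<close>.\<close>

lemma hausdorff_measure_eq_0_unit_interval:
  fixes A :: "real set"
  assumes "A \<subseteq> {0..1}" and s: "s > 1"
  shows "hausdorff_measure s A = 0"
proof -
  have "hausdorff_content s \<delta> A = 0" if "\<delta> > 0" for \<delta>
  proof -
    have bound: "hausdorff_content s \<delta> A \<le> ennreal (real N powr (1 - s))"
      if N: "N \<ge> 1" "1 / real N \<le> \<delta>" for N :: nat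
    proof -
      define U where "U = (\<lambda>i::nat. if i < N then {real i / real N .. real (Suc i) / real N} else {})"
      have diam: "diameter (U i) = (if i < N then 1 / real N else 0)" for i
      proof (cases "i < N")
        case True
        have "real i / real N \<le> real (Suc i) / real N"
          using N by (intro divide_right_mono) auto
        moreover have "real (Suc i) / real N - real i / real N = 1 / real N"
          by (simp add: diff_divide_distrib[symmetric])
        ultimately show ?thesis
          using True by (simp add: U_def diameter_closed_interval)
      qed (simp add: U_def)
      have "A \<subseteq> (\<Union>i. U i)"
      proof
        fix x assume "x \<in> A"
        then have x: "0 \<le> x" "x \<le> 1" using assms by auto
        show "x \<in> (\<Union>i. U i)"
        \<comment> \<open>At the right endpoint the floor would give the index \<open>N\<close>,
          whose set is empty; the closed interval with index \<open>N - 1\<close> contains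
          it.\<close>
        proof (cases "x = 1")
          case True
          then have "x \<in> U (N - 1)" using N by (auto simp: U_def)
          then show ?thesis by blast
        next
          case False
          define i where "i = nat \<lfloor>x * real N\<rfloor>"
          have *: "real i \<le> x * real N" "x * real N < real i + 1"
            unfolding i_def using x by (auto simp: of_nat_nat)
          have "x * real N < 1 * real N" using False x N by (intro mult_strict_right_mono) auto
          then have "i < N" using * by linarith
          then have "x \<in> U i" using * N by (auto simp: U_def field_simps)
          then show ?thesis by blast
        qed
      qed
      then have "U \<in> delta_covers \<delta> A"
        using N \<open>\<delta> > 0\<close> by (auto simp: delta_covers_def diam) (auto simp: U_def)
      then have "hausdorff_content s \<delta> A \<le> (\<Sum>i. diam_powr s (U i))"
        unfolding hausdorff_content_def by (rule INF_lower)
      also have "\<dots> = (\<Sum>i<N. diam_powr s (U i))"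
        by (rule suminf_finite) (auto simp: U_def diam_powr_def)
      also have "\<dots> \<le> (\<Sum>i<N. ennreal ((1 / real N) powr s))"
        using s by (intro sum_mono) (auto simp: diam_powr_def diam)
      also have "\<dots> = ennreal (real N * (1 / real N) powr s)"
        by (simp add: ennreal_of_nat_eq_real_of_nat ennreal_mult')
      also have "real N * (1 / real N) powr s = real N powr (1 - s)"
        using N by (simp add: powr_diff powr_divide)
      finally show ?thesis .
    qed
    have "(\<lambda>N. ennreal (real N powr (1 - s))) \<longlonglongrightarrow> ennreal 0"
      using s by (intro tendsto_ennrealI) real_asymp
    moreover have "eventually (\<lambda>N. hausdorff_content s \<delta> A \<le> ennreal (real N powr (1 - s))) sequentially"
    proof -
      have "(\<lambda>N. 1 / real N) \<longlonglongrightarrow> 0" by real_asymp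
      then have "eventually (\<lambda>N. 1 / real N < \<delta>) sequentially"
        using \<open>\<delta> > 0\<close> by (rule order_tendstoD)
      then show ?thesis
        using eventually_ge_at_top[of 1] by eventually_elim (use bound in auto)
    qed
    ultimately have "hausdorff_content s \<delta> A \<le> ennreal 0"
      by (intro tendsto_lowerbound) auto
    then show ?thesis by simp
  qed
  then show ?thesis
    unfolding hausdorff_measure_def by simp
qed

lemma hausdorff_dim_le_1:
  fixes A :: "real set"
  assumes "A \<subseteq> {0..1}"
  shows "hausdorff_dim A \<le> 1"
proof (rule ennreal_le_epsilon)
  fix e :: real assume "e > 0"
  then have "hausdorff_measure (1 + e) A = 0"
    using assms by (intro hausdorff_measure_eq_0_unit_interval) auto
  then have "hausdorff_dim A \<le> ennreal (1 + e)"
    unfolding hausdorff_dim_def using \<open>e > 0\<close> by (intro INF_lower) auto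
  then show "hausdorff_dim A \<le> 1 + ennreal e"
    using \<open>e > 0\<close> by (simp add: ennreal_plus flip: ennreal_1)
qed

text \<open>For exponent 0 every nonempty covering set counts 1. This exponent belongs to the
  infimum defining the dimension, while the mass distribution argument needs
  \<open>s > 0\<close>.\<close>

lemma hausdorff_measure_0_nonzero:
  assumes "A \<noteq> {}"
  shows "hausdorff_measure 0 A \<noteq> 0"
proof -
  have "1 \<le> hausdorff_content 0 1 A"
    unfolding hausdorff_content_def
  proof (rule INF_greatest)
    fix U assume "U \<in> delta_covers 1 A"
    then obtain i where "U i \<noteq> {}"
      using assms by (fastforce simp: delta_covers_def)
    then have "1 = (\<Sum>j\<in>{i}. diam_powr 0 (U j))"
      by (simp add: diam_powr_def)
    also have "\<dots> \<le> (\<Sum>j. diam_powr 0 (U j))"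
      by (intro sum_le_suminf) auto
    finally show "1 \<le> (\<Sum>j. diam_powr 0 (U j))" .
  qed
  also have "\<dots> \<le> hausdorff_measure 0 A"
    unfolding hausdorff_measure_def by (rule SUP_upper) auto
  finally show ?thesis by auto
qed

text \<open>
  Mass distribution principle without a measure on \<open>A\<close>: the inverse of \<open>G\<close> is H\<ouml>lder, so a cover
  of \<open>A\<close> pulls back to a cover of the unit interval, whose Lebesgue measure is 1.
\<close>

lemma hausdorff_measure_nonzero:
  fixes G :: "real \<Rightarrow> 'a::metric_space"
  assumes s: "s > 0" and K: "K > 0"
    and G: "\<And>u. u \<in> {0..<1} \<Longrightarrow> G u \<in> A"
    and expand: "\<And>u v. u \<in> {0..<1} \<Longrightarrow> v \<in> {0..<1} \<Longrightarrow> \<bar>u - v\<bar> \<le> K * dist (G u) (G v) powr s"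
  shows "hausdorff_measure s A \<noteq> 0"
proof -
  have low: "ennreal (1 / (2 * K)) \<le> (\<Sum>i. diam_powr s (U i))" if "U \<in> delta_covers 1 A" for U
  proof -
    define V where "V = (\<lambda>i. {u \<in> {0..<1}. G u \<in> U i})"
    \<comment> \<open>Any point of \<open>V i\<close> serves as centre: \<open>expand\<close> puts
      all of \<open>V i\<close> into the closed interval \<open>I i\<close> around it, which spares
      the question whether \<open>V i\<close> is measurable.\<close>
    define c where "c = (\<lambda>i. SOME u. u \<in> V i)"
    define r where "r = (\<lambda>i. K * diameter (U i) powr s)"
    define I where "I = (\<lambda>i. if V i = {} then {} else {c i - r i .. c i + r i})"
    have r0: "r i \<ge> 0" for i using K by (auto simp: r_def)
    have bdd: "bounded (U i)" for i using that by (auto simp: delta_covers_def)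
    have VI: "V i \<subseteq> I i" for i
    proof
      fix u assume u: "u \<in> V i"
      then have c: "c i \<in> V i" unfolding c_def by (rule someI)
      have "\<bar>u - c i\<bar> \<le> K * dist (G u) (G (c i)) powr s"
        using u c by (intro expand) (auto simp: V_def)
      also have "\<dots> \<le> r i"
        unfolding r_def using u c K s bdd[of i]
        by (intro mult_left_mono powr_mono2 diameter_bounded_bound) (auto simp: V_def)
      finally show "u \<in> I i" using u by (auto simp: I_def)
    qed
    have "{0..<1} \<subseteq> (\<Union>i. V i)"
      using G that by (fastforce simp: V_def delta_covers_def)
    then have sub: "{0..<1} \<subseteq> (\<Union>i. I i)" using VI by blast
    have "1 = emeasure lborel {0..<1::real}" by simp
    also have "\<dots> \<le> emeasure lborel (\<Union>i. I i)"
      by (intro emeasure_mono sub) (auto simp: I_def)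
    also have "\<dots> \<le> (\<Sum>i. emeasure lborel (I i))"
      by (intro emeasure_subadditive_countably) (auto simp: I_def)
    also have "\<dots> \<le> (\<Sum>i. ennreal (2 * K) * diam_powr s (U i))"
    proof (intro suminf_le)
      fix i
      show "emeasure lborel (I i) \<le> ennreal (2 * K) * diam_powr s (U i)"
      proof (cases "V i = {}")
        case False
        then have "U i \<noteq> {}" by (auto simp: V_def)
        then have "ennreal (2 * K) * diam_powr s (U i) = ennreal (2 * r i)"
          using s K by (simp add: diam_powr_def r_def ennreal_mult'[symmetric] mult.assoc)
        moreover have "emeasure lborel (I i) = ennreal (2 * r i)"
          using False r0[of i] by (simp add: I_def)
        ultimately show ?thesis by simp
      qed (simp add: I_def)
    qed auto
    also have "\<dots> = ennreal (2 * K) * (\<Sum>i. diam_powr s (U i))"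
      by simp
    finally have "ennreal (1 / (2 * K)) * 1
        \<le> ennreal (1 / (2 * K)) * (ennreal (2 * K) * (\<Sum>i. diam_powr s (U i)))"
      by (intro mult_left_mono) auto
    also have "\<dots> = (\<Sum>i. diam_powr s (U i))"
      using K by (simp add: mult.assoc[symmetric] ennreal_mult'[symmetric])
    finally show ?thesis by simp
  qed
  have "ennreal (1 / (2 * K)) \<le> hausdorff_content s 1 A"
    unfolding hausdorff_content_def by (intro INF_greatest low)
  also have "\<dots> \<le> hausdorff_measure s A"
    unfolding hausdorff_measure_def by (rule SUP_upper) auto
  finally show ?thesis using K by auto
qed

lemma hausdorff_dim_ge_1:
  assumes "A \<noteq> {}" and "\<And>s. 0 < s \<Longrightarrow> s < 1 \<Longrightarrow> hausdorff_measure s A \<noteq> 0"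
  shows "hausdorff_dim A \<ge> 1"
  unfolding hausdorff_dim_def
proof (rule INF_greatest)
  fix s assume s: "s \<in> {s. 0 \<le> s \<and> hausdorff_measure s A = 0}"
  then have "\<not> s < 1"
    using assms hausdorff_measure_0_nonzero[OF assms(1)] by (cases "s = 0") auto
  then show "1 \<le> ennreal s" by (simp flip: ennreal_1 add: ennreal_leI)
qed

subsection \<open>Coding the unit interval by a tree of weights\<close>

text \<open>For nonnegative \<open>f\<close>, intervals of lengths \<open>f b\<close>, laid side by
  side in the order of \<open>b\<close>, tile the unit interval; \<open>k\<close> names the one
  containing \<open>u\<close>, and \<open>v\<close> is the relative position of \<open>u\<close> in
  it.\<close>

lemma select_subinterval:
  fixes f :: "nat \<Rightarrow> real"
  assumes "finite S" "sum f S = 1" "0 \<le> u" "u < 1"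
  shows "\<exists>k v. k \<in> S \<and> 0 \<le> v \<and> v < 1 \<and> u = (\<Sum>b\<in>{b\<in>S. b < k}. f b) + f k * v"
proof -
  define F where "F = (\<lambda>k. \<Sum>b\<in>{b\<in>S. b < k}. f b)"
  \<comment> \<open>\<open>F k\<close> is the first partial sum exceeding \<open>u\<close>. The
    wanted digit is the predecessor \<open>j\<close>; as \<open>F\<close> jumps there,
    \<open>j\<close> lies in \<open>S\<close> and has positive weight.\<close>
  define k where "k = (LEAST k. u < F k)"
  obtain m where "\<forall>b\<in>S. b < m" using assms(1) finite_nat_set_iff_bounded by blast
  then have "{b \<in> S. b < m} = S" by auto
  then have "u < F m" using assms by (simp add: F_def)
  then have 1: "u < F k" unfolding k_def by (rule LeastI)
  have "k \<noteq> 0" using 1 assms by (intro notI) (simp add: F_def)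
  then obtain j where j: "k = Suc j" by (cases k) auto
  then have 2: "F j \<le> u" using not_less_Least[of j "\<lambda>k. u < F k"] by (simp add: k_def)
  have "{b \<in> S. b < Suc j} = {b \<in> S. b < j} \<union> (if j \<in> S then {j} else {})"
    by (auto simp: less_Suc_eq)
  then have 3: "F (Suc j) = F j + (if j \<in> S then f j else 0)"
    using assms(1) by (auto simp: F_def)
  then have "j \<in> S" "f j > 0" using 1 2 j by (auto split: if_splits)
  then have "j \<in> S \<and> 0 \<le> (u - F j) / f j \<and> (u - F j) / f j < 1
      \<and> u = F j + f j * ((u - F j) / f j)"
    using 1 2 3 j by (auto simp: field_simps)
  then show ?thesis unfolding F_def by blast
qed

text \<open>\<open>p h b\<close> is the share of child \<open>b\<close> in the interval of the word
  \<open>h\<close>. Repeated selection gives every \<open>u\<close> a digit sequence; points sharing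
  \<open>n\<close> digits lie in one interval of level \<open>n\<close>, whose length is the product
  of the shares.\<close>

lemma tree_coding:
  fixes p :: "nat list \<Rightarrow> nat \<Rightarrow> real"
  assumes "\<And>h. finite (S h)" "\<And>h. sum (p h) (S h) = 1" "\<And>h b. p h b \<ge> 0"
  shows "\<exists>d. (\<forall>u\<in>{0..<1}. \<forall>n. d u n \<in> S (map (d u) [0..<n])) \<and>
    (\<forall>u\<in>{0..<1}. \<forall>v\<in>{0..<1}. \<forall>n. (\<forall>i<n. d u i = d v i) \<longrightarrow>
       \<bar>u - v\<bar> \<le> (\<Prod>i<n. p (map (d u) [0..<i]) (d u i)))"
proof -
  define P where "P = (\<lambda>h u (k, v). k \<in> S h \<and> v \<in> {0..<1} \<and>
      u = (\<Sum>b\<in>{b\<in>S h. b < k}. p h b) + p h k * v)"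
  define dig where "dig = (\<lambda>h u. fst (SOME z. P h u z))"
  define nxt where "nxt = (\<lambda>h u. snd (SOME z. P h u z))"
  have sel: "dig h u \<in> S h \<and> nxt h u \<in> {0..<1} \<and>
      u = (\<Sum>b\<in>{b\<in>S h. b < dig h u}. p h b) + p h (dig h u) * nxt h u"
    if "u \<in> {0..<1}" for h u
  proof -
    have "\<exists>z. P h u z"
      using select_subinterval[OF assms(1,2), of u h] that by (auto simp: P_def)
    then have "P h u (SOME z. P h u z)" by (rule someI_ex)
    then show ?thesis by (simp add: P_def dig_def nxt_def split: prod.splits)
  qed
  \<comment> \<open>The state is the word read so far together with the relative position of
    \<open>u\<close> in its interval.\<close>
  define w where "w = (\<lambda>u. rec_nat ([], u) (\<lambda>_ (h, v). (h @ [dig h v], nxt h v)))"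
  have w0: "w u 0 = ([], u)" and
    wS: "w u (Suc n) = (fst (w u n) @ [dig (fst (w u n)) (snd (w u n))], nxt (fst (w u n)) (snd (w u n)))"
    for u n by (simp_all add: w_def split: prod.splits)
  define d where "d = (\<lambda>u n. dig (fst (w u n)) (snd (w u n)))"
  have d: "d u n = dig (fst (w u n)) (snd (w u n))" for u n
    by (simp add: d_def)
  have h: "fst (w u n) = map (d u) [0..<n]" for u n
    by (induction n) (simp_all add: w0 wS d)
  have dig: "dig (map (d u) [0..<n]) (snd (w u n)) = d u n"
    and nxt: "nxt (map (d u) [0..<n]) (snd (w u n)) = snd (w u (Suc n))" for u n
    using d[of u n] by (simp_all only: h wS snd_conv)
  have range: "snd (w u n) \<in> {0..<1}" if "u \<in> {0..<1}" for u n
  proof (induction n)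
    case (Suc n)
    then show ?case using sel[OF Suc] unfolding wS snd_conv by blast
  qed (use that w0 in simp)
  have step: "snd (w u n) = (\<Sum>b\<in>{b\<in>S (map (d u) [0..<n]). b < d u n}. p (map (d u) [0..<n]) b)
      + p (map (d u) [0..<n]) (d u n) * snd (w u (Suc n))" if "u \<in> {0..<1}" for u n
    using sel[OF range[OF that, of n], of "map (d u) [0..<n]"] unfolding dig nxt by blast
  \<comment> \<open>The induction needs an exact identity: each common digit rescales the difference
    of the relative positions by the same share.\<close>
  have diff: "\<bar>u - v\<bar> = (\<Prod>i<n. p (map (d u) [0..<i]) (d u i)) * \<bar>snd (w u n) - snd (w v n)\<bar>"
    if uv: "u \<in> {0..<1}" "v \<in> {0..<1}" and "\<forall>i<n. d u i = d v i" for u v n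
    using that(3)
  proof (induction n)
    case (Suc n)
    have eq: "map (d v) [0..<n] = map (d u) [0..<n]" "d v n = d u n"
      using Suc.prems by auto
    have "snd (w u n) - snd (w v n)
        = p (map (d u) [0..<n]) (d u n) * (snd (w u (Suc n)) - snd (w v (Suc n)))"
      using step[OF uv(1), of n] step[OF uv(2), of n] unfolding eq by (simp add: algebra_simps)
    then have "\<bar>snd (w u n) - snd (w v n)\<bar>
        = p (map (d u) [0..<n]) (d u n) * \<bar>snd (w u (Suc n)) - snd (w v (Suc n))\<bar>"
      using assms(3) by (simp add: abs_mult)
    then show ?case using Suc by simp
  qed (simp add: w0)
  show ?thesis
  proof (intro exI[of _ d] conjI ballI allI impI)
    fix u n assume "u \<in> {0..<1::real}"
    then show "d u n \<in> S (map (d u) [0..<n])"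
      using sel[OF range[of u n], of "map (d u) [0..<n]"] unfolding dig by blast
  next
    fix u v :: real and n
    assume uv: "u \<in> {0..<1}" "v \<in> {0..<1}" "\<forall>i<n. d u i = d v i"
    have "\<bar>snd (w u n) - snd (w v n)\<bar> \<le> 1"
      using range[OF uv(1), of n] range[OF uv(2), of n] by auto
    then show "\<bar>u - v\<bar> \<le> (\<Prod>i<n. p (map (d u) [0..<i]) (d u i))"
      unfolding diff[OF uv] using assms(3) by (intro mult_left_le prod_nonneg) auto
  qed
qed

subsection \<open>The number with given partial quotients\<close>

text \<open>Digits start at index 0, so \<open>a n\<close> becomes partial quotient number
  \<open>Suc n\<close>. The limit exists if all digits are positive.\<close>

definition cf_val :: "(nat \<Rightarrow> nat) \<Rightarrow> real" where
  "cf_val a = lim (\<lambda>n. cfrac (map a [0..<n]))"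

lemma cfrac_upt_Suc:
  "cfrac (map a [0..<Suc n]) = 1 / (real (a 0) + cfrac (map (\<lambda>i. a (Suc i)) [0..<n]))"
  by (simp add: map_upt_Suc del: upt_Suc)

lemma cfrac_upt_bounds:
  assumes "\<And>i. a i > 0"
  shows "0 \<le> cfrac (map a [0..<n])" "cfrac (map a [0..<n]) \<le> 1"
  using cfrac_bounds[of "map a [0..<n]"] assms by auto

text \<open>One step \<open>1 / (a + y)\<close> is not uniformly contracting when
  \<open>a = 1\<close>, but two steps contract by a factor 4 (\<open>recip_diff2\<close>); hence
  digits are removed in pairs.\<close>

lemma cfrac_upt_diff:
  assumes "\<And>i. a i > 0" "N \<le> m" "N \<le> n"
  shows "\<bar>cfrac (map a [0..<m]) - cfrac (map a [0..<n])\<bar> \<le> (1 / 2) ^ (N - 1)"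
  using assms
proof (induction N arbitrary: a m n rule: less_induct)
  case (less N)
  show ?case
  proof (cases "N < 2")
    case True
    then have "N - 1 = 0" by simp
    then show ?thesis
      using cfrac_upt_bounds[of a n] cfrac_upt_bounds[of a m] less.prems by fastforce
  next
    case False
    then obtain k where k: "N = Suc (Suc k)"
      by (metis One_nat_def Suc_1 less_2_cases_iff not0_implies_Suc)
    define m' where "m' = m - 2"
    have m: "m = Suc (Suc m')"
      unfolding m'_def using less.prems(2,3) k by linarith
    define n' where "n' = n - 2"
    have n: "n = Suc (Suc n')"
      unfolding n'_def using less.prems(2,3) k by linarith
    define b where "b = (\<lambda>i. a (Suc (Suc i)))"
    have b: "b i > 0" for i using less.prems by (simp add: b_def)
    have a1: "real (a i) \<ge> 1" for i using less.prems(1)[of i] by linarith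
    have "\<bar>cfrac (map a [0..<m]) - cfrac (map a [0..<n])\<bar>
        \<le> \<bar>cfrac (map b [0..<m']) - cfrac (map b [0..<n'])\<bar> / 4"
      unfolding m n cfrac_upt_Suc b_def[symmetric] using a1 b
      by (intro recip_diff2 cfrac_upt_bounds) auto
    also have "\<dots> \<le> (1 / 2) ^ (k - 1) / 4"
      using less.IH[of k b m' n'] b less.prems k m n by auto
    also have "\<dots> \<le> (1 / 2) ^ (N - 1)"
      by (cases k) (simp_all add: k)
    finally show ?thesis .
  qed
qed

lemma cf_val_LIMSEQ:
  assumes pos: "\<And>i. a i > 0"
  shows "(\<lambda>n. cfrac (map a [0..<n])) \<longlonglongrightarrow> cf_val a"
proof -
  have "Cauchy (\<lambda>n. cfrac (map a [0..<n]))"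
    unfolding Cauchy_def
  proof (intro allI impI)
    fix e :: real assume "e > 0"
    then obtain N where N: "(1 / 2) ^ N < e"
      using real_arch_pow_inv[of e "1 / 2"] by auto
    have "dist (cfrac (map a [0..<m])) (cfrac (map a [0..<n])) < e"
      if "m \<ge> Suc N" "n \<ge> Suc N" for m n
      using cfrac_upt_diff[of a, OF pos that] N by (simp add: dist_real_def)
    then show "\<exists>M. \<forall>m\<ge>M. \<forall>n\<ge>M. dist (cfrac (map a [0..<m])) (cfrac (map a [0..<n])) < e"
      by blast
  qed
  then show ?thesis
    unfolding cf_val_def by (simp add: Cauchy_convergent convergent_LIMSEQ_iff[symmetric])
qed

lemma cf_val_bounds:
  assumes pos: "\<And>i. a i > 0"
  shows "0 \<le> cf_val a" "cf_val a \<le> 1"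
proof -
  show "0 \<le> cf_val a"
    by (rule LIMSEQ_le_const[OF cf_val_LIMSEQ[OF pos]]) (use cfrac_upt_bounds(1)[of a, OF pos] in blast)
  show "cf_val a \<le> 1"
    by (rule LIMSEQ_le_const2[OF cf_val_LIMSEQ[OF pos]]) (use cfrac_upt_bounds(2)[of a, OF pos] in blast)
qed

lemma cf_val_rec:
  assumes pos: "\<And>i. a i > 0"
  shows "cf_val a = 1 / (real (a 0) + cf_val (\<lambda>i. a (Suc i)))"
proof (rule LIMSEQ_unique)
  have "(\<lambda>n. cfrac (map a [0..<Suc n])) \<longlonglongrightarrow> cf_val a"
    using LIMSEQ_Suc[OF cf_val_LIMSEQ[of a]] pos by simp
  then show "(\<lambda>n. 1 / (real (a 0) + cfrac (map (\<lambda>i. a (Suc i)) [0..<n]))) \<longlonglongrightarrow> cf_val a"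
    unfolding cfrac_upt_Suc .
  have "real (a 0) + cf_val (\<lambda>i. a (Suc i)) \<noteq> 0"
    using cf_val_bounds(1)[of "\<lambda>i. a (Suc i)"] pos
    by (metis add_nonneg_eq_0_iff less_irrefl of_nat_0_le_iff of_nat_eq_0_iff)
  then show "(\<lambda>n. 1 / (real (a 0) + cfrac (map (\<lambda>i. a (Suc i)) [0..<n]))) \<longlonglongrightarrow>
      1 / (real (a 0) + cf_val (\<lambda>i. a (Suc i)))"
    using cf_val_LIMSEQ[of "\<lambda>i. a (Suc i)"] pos by (intro tendsto_intros) auto
qed

lemma cf_val_strict_bounds:
  assumes pos: "\<And>i. a i > 0"
  shows "0 < cf_val a" "cf_val a < 1"
proof -
  have pos': "cf_val b > 0" if "\<And>i. b i > 0" for b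
  proof -
    have "real (b 0) > 0" using that by simp
    then show ?thesis
      using cf_val_bounds(1)[of "\<lambda>i. b (Suc i)"] that
      unfolding cf_val_rec[of b, OF that] by (intro divide_pos_pos add_pos_nonneg) auto
  qed
  show "0 < cf_val a" using pos' pos .
  have "real (a 0) \<ge> 1" using pos[of 0] by linarith
  then show "cf_val a < 1"
    using pos'[of "\<lambda>i. a (Suc i)"] pos cf_val_rec[of a] by simp
qed

lemma recip_cf_val:
  assumes pos: "\<And>i. a i > 0"
  shows "1 / cf_val a = real (a 0) + cf_val (\<lambda>i. a (Suc i))"
  by (subst cf_val_rec[OF pos]) simp

text \<open>Passing to the tail turns a fraction \<open>p / q\<close> into one with denominator \<open>p < q\<close>.\<close>

lemma cf_val_irrational:
  assumes "\<And>i. a i > 0"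
  shows "cf_val a \<notin> \<rat>"
proof -
  have "cf_val a * real q \<noteq> real p" if "\<And>i. a i > 0" "q > 0" for a p q
    using that
  proof (induction q arbitrary: a p rule: less_induct)
    case (less q)
    show ?case
    proof
      assume eq: "cf_val a * real q = real p"
      have x: "0 < cf_val a" "cf_val a < 1"
        using cf_val_strict_bounds[of a] less.prems by auto
      have "real p > 0" using x less.prems by (simp flip: eq)
      then have p: "p > 0" by simp
      have "cf_val a * real q < 1 * real q"
        using x less.prems by (intro mult_strict_right_mono) auto
      then have "p < q" using eq by simp
      define y where "y = cf_val (\<lambda>i. a (Suc i))"
      have "y = real q / real p - real (a 0)"
      proof -
        have "cf_val a = real p / real q" using eq less.prems by (simp add: field_simps)
        then show ?thesis using recip_cf_val[of a] less.prems by (simp add: y_def)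
      qed
      then have y: "y * real p = real q - real (a 0 * p)"
        using p by (simp add: field_simps)
      have "y \<ge> 0"
        using cf_val_bounds[of "\<lambda>i. a (Suc i)"] less.prems by (simp add: y_def)
      then have "y * real p \<ge> 0" by simp
      \<comment> \<open>This makes the subtraction of natural numbers below exact.\<close>
      then have "a 0 * p \<le> q" using y by linarith
      then have "y * real p = real (q - a 0 * p)" using y by (simp add: of_nat_diff)
      then show False
        using less.IH[OF \<open>p < q\<close>, of "\<lambda>i. a (Suc i)"] less.prems p unfolding y_def by blast
    qed
  qed
  note no_fraction = this
  show ?thesis
  proof
    assume "cf_val a \<in> \<rat>"
    then obtain m n where mn: "n \<noteq> 0" "\<bar>cf_val a\<bar> = real m / real n"
      by (rule Rats_abs_nat_div_natE) auto
    then have "cf_val a * real n = real m"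
      using cf_val_strict_bounds[of a] assms by simp
    then show False using no_fraction[of a n m] assms mn by simp
  qed
qed

lemma gauss_map_cf_val:
  assumes "\<And>i. a i > 0"
  shows "gauss_map (cf_val a) = cf_val (\<lambda>i. a (Suc i))"
proof -
  have "0 < cf_val (\<lambda>i. a (Suc i))" "cf_val (\<lambda>i. a (Suc i)) < 1"
    using cf_val_strict_bounds[of "\<lambda>i. a (Suc i)"] assms by simp_all
  then show ?thesis
    unfolding gauss_map_def recip_cf_val[OF assms] by (subst frac_unique_iff) auto
qed

text \<open>Links freely chosen digits to the Gauss map: the strict bounds on the tail make
  \<open>a 0\<close> the floor of the reciprocal, and the map then shifts the sequence.\<close>

lemma partial_quotient_cf_val:
  assumes "\<And>i. a i > 0"
  shows "partial_quotient (Suc n) (cf_val a) = a n"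
  using assms
proof (induction n arbitrary: a)
  case 0
  have "0 < cf_val (\<lambda>i. a (Suc i))" "cf_val (\<lambda>i. a (Suc i)) < 1"
    using cf_val_strict_bounds[of "\<lambda>i. a (Suc i)"] 0 by simp_all
  then have "\<lfloor>real (a 0) + cf_val (\<lambda>i. a (Suc i))\<rfloor> = int (a 0)"
    by (intro floor_unique) simp_all
  then show ?case unfolding partial_quotient_1 recip_cf_val[OF 0] by simp
next
  case (Suc n)
  have "partial_quotient (Suc (Suc n)) (cf_val a) = partial_quotient (Suc n) (gauss_map (cf_val a))"
    by (rule partial_quotient_Suc) simp
  also have "\<dots> = a (Suc n)"
    unfolding gauss_map_cf_val[of a, OF Suc.prems] by (rule Suc.IH) (rule Suc.prems)
  finally show ?case .
qed

subsection \<open>Cylinders\<close>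

text \<open>
  \<open>denoms h = (q\<^sub>n, q\<^bsub>n-1\<^esub>)\<close> for the word \<open>h\<close> of length \<open>n\<close>; \<open>cyl h\<close> is the length of the interval
  of all numbers whose expansion starts with \<open>h\<close>.
\<close>

definition denoms :: "nat list \<Rightarrow> real \<times> real" where
  "denoms h = foldl (\<lambda>(q, q') b. (real b * q + q', q)) (1, 0) h"

definition cyl :: "nat list \<Rightarrow> real" where
  "cyl h = (case denoms h of (q, q') \<Rightarrow> 1 / (q * (q + q')))"

lemma denoms_Nil: "denoms [] = (1, 0)"
  by (simp add: denoms_def)

lemma denoms_snoc: "denoms h = (q, q') \<Longrightarrow> denoms (h @ [b]) = (real b * q + q', q)"
  by (simp add: denoms_def)

lemma denoms_bounds:
  assumes "denoms h = (q, q')" "\<And>b. b \<in> set h \<Longrightarrow> b > 0"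
  shows "1 \<le> q" "0 \<le> q'" "q' \<le> q"
proof -
  have "1 \<le> q \<and> 0 \<le> q' \<and> q' \<le> q"
    using assms
  proof (induction h arbitrary: q q' rule: rev_induct)
    case (snoc b h)
    obtain r r' where r: "denoms h = (r, r')" by fastforce
    have IH: "1 \<le> r \<and> 0 \<le> r' \<and> r' \<le> r" using snoc r by auto
    have "b > 0" using snoc.prems by simp
    then have "real b \<ge> 1" by linarith
    then have "1 * r \<le> real b * r" using IH by (intro mult_right_mono) auto
    then have "1 \<le> real b * r + r' \<and> 0 \<le> r \<and> r \<le> real b * r + r'"
      using IH by linarith
    then show ?case using snoc.prems(1) denoms_snoc[OF r, of b] by force
  qed (simp add: denoms_Nil)
  then show "1 \<le> q" "0 \<le> q'" "q' \<le> q" by auto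
qed

lemma cyl_eq: "denoms h = (q, q') \<Longrightarrow> cyl h = 1 / (q * (q + q'))"
  by (simp add: cyl_def)

lemma cyl_snoc_eq:
  "denoms h = (q, q') \<Longrightarrow> cyl (h @ [b]) = 1 / ((real b * q + q') * (real (Suc b) * q + q'))"
  using cyl_eq[OF denoms_snoc] by (simp add: algebra_simps)

lemma cyl_pos:
  assumes "\<And>b. b \<in> set h \<Longrightarrow> b > 0"
  shows "cyl h > 0"
proof -
  obtain q q' where q: "denoms h = (q, q')" by fastforce
  note denoms_bounds[OF q assms]
  then show ?thesis by (auto simp: cyl_eq[OF q] intro!: divide_pos_pos mult_pos_pos)
qed

text \<open>The extreme case is \<open>b = 1\<close>, where the ratio is
  \<open>q / (2 * q + q')\<close>.\<close>

lemma cyl_snoc_le_half: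
  assumes "\<And>b. b \<in> set h \<Longrightarrow> b > 0" "b > 0"
  shows "cyl (h @ [b]) \<le> cyl h / 2"
proof -
  obtain q q' where q: "denoms h = (q, q')" by fastforce
  note bds = denoms_bounds[OF q assms(1)]
  have b: "real b \<ge> 1" using assms by linarith
  have "(q + q') * (2 * q) \<le> (real b * q + q') * (real (Suc b) * q + q')"
  proof (rule mult_mono)
    have "1 * q \<le> real b * q" "2 * q \<le> real (Suc b) * q"
      using b bds by (auto intro!: mult_right_mono)
    then show "q + q' \<le> real b * q + q'" "2 * q \<le> real (Suc b) * q + q'"
      using bds by linarith+
  qed (use bds b in auto)
  then have "1 / ((real b * q + q') * (real (Suc b) * q + q')) \<le> 1 / ((q + q') * (2 * q))"
    using bds b by (intro divide_left_mono mult_pos_pos add_pos_nonneg) auto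
  then show ?thesis
    unfolding cyl_eq[OF q] cyl_snoc_eq[OF q] by (simp add: mult_ac)
qed

text \<open>Gives the cost of a prescribed digit. The two denominators of the child are at most
  \<open>(b + 1) * q\<close>, by \<open>q' \<le> q\<close>, and
  \<open>(b + 1) * (q + q')\<close>.\<close>

lemma cyl_snoc_ge:
  assumes "\<And>b. b \<in> set h \<Longrightarrow> b > 0" "b > 0"
  shows "cyl h \<le> cyl (h @ [b]) * (real b + 1)\<^sup>2"
proof -
  obtain q q' where q: "denoms h = (q, q')" by fastforce
  note bds = denoms_bounds[OF q assms(1)]
  have b: "real b \<ge> 1" using assms by linarith
  have "0 \<le> real b * q'" using bds by simp
  then have "(real b * q + q') * (real (Suc b) * q + q') \<le> ((real b + 1) * q) * ((real b + 1) * (q + q'))"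
    using bds b by (intro mult_mono) (auto simp: algebra_simps)
  then have le: "(real b * q + q') * (real (Suc b) * q + q') \<le> (real b + 1)\<^sup>2 * (q * (q + q'))"
    by (simp only: power2_eq_square mult_ac)
  have "0 < q * (q + q')" "0 < (real b * q + q') * (real (Suc b) * q + q')"
    using bds b by (auto intro!: mult_pos_pos add_pos_nonneg)
  then have "1 / (q * (q + q')) \<le> (real b + 1)\<^sup>2 / ((real b * q + q') * (real (Suc b) * q + q'))"
    using le by (simp add: divide_le_eq le_divide_eq mult.commute del: of_nat_Suc mult_pos_pos zero_less_mult_iff)
  then show ?thesis
    unfolding cyl_eq[OF q] cyl_snoc_eq[OF q] by simp
qed

lemma cyl_le:
  assumes "\<And>b. b \<in> set h \<Longrightarrow> b > 0"
  shows "cyl h \<le> (1 / 2) ^ length h"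
  using assms
proof (induction h rule: rev_induct)
  case (snoc b h)
  have "cyl (h @ [b]) \<le> cyl h / 2" by (rule cyl_snoc_le_half) (use snoc.prems in auto)
  moreover have "cyl h \<le> (1 / 2) ^ length h" by (rule snoc.IH) (use snoc.prems in auto)
  ultimately show ?case by simp
qed (simp add: cyl_def denoms_Nil)

text \<open>
  The lengths of the subcylinders telescope, so digits up to \<open>M\<close> fill all but a fraction
  \<open>O(1/M)\<close>; as each is at most half of the parent, raising to a power \<open>s < 1\<close> gains a
  factor \<open>2\<^bsup>1-s\<^esup>\<close>.
\<close>

lemma sum_cyl_snoc:
  assumes "\<And>b. b \<in> set h \<Longrightarrow> b > 0"
  shows "(\<Sum>b=1..M. cyl (h @ [b])) \<ge> cyl h * (1 - 2 / (real M + 1))"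
proof -
  obtain q q' where q: "denoms h = (q, q')" by fastforce
  note bds = denoms_bounds[OF q assms]
  have pos: "real b * q + q' > 0" if "b \<ge> 1" for b
    using bds that by (intro add_pos_nonneg mult_pos_pos) auto
  have "(\<Sum>b=1..M. cyl (h @ [b])) = (\<Sum>b=1..M. 1 / q * (1 / (real b * q + q') - 1 / (real (Suc b) * q + q')))"
  proof (intro sum.cong refl)
    fix b assume "b \<in> {1..M}"
    then show "cyl (h @ [b]) = 1 / q * (1 / (real b * q + q') - 1 / (real (Suc b) * q + q'))"
      unfolding cyl_snoc_eq[OF q] using pos[of b] pos[of "Suc b"] bds
      by (simp add: divide_simps) (simp add: algebra_simps)
  qed
  also have "\<dots> = 1 / q * (1 / (q + q') - 1 / (real (Suc M) * q + q'))"
  proof -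
    have "(\<Sum>b=1..M. 1 / (real b * q + q') - 1 / (real (Suc b) * q + q'))
        = 1 / (q + q') - 1 / (real (Suc M) * q + q')"
      by (induction M) simp_all
    then show ?thesis by (simp only: sum_distrib_left[symmetric])
  qed
  also have "\<dots> \<ge> 1 / q * (1 / (q + q') - 2 / ((real M + 1) * (q + q')))"
  proof -
    have "(real M + 1) * q' \<le> (real M + 1) * q" using bds by (intro mult_left_mono) auto
    then have "(real M + 1) * (q + q') \<le> 2 * (real (Suc M) * q + q')"
      using bds by (simp add: algebra_simps)
    then have "2 / (2 * (real (Suc M) * q + q')) \<le> 2 / ((real M + 1) * (q + q'))"
      using bds by (intro divide_left_mono mult_pos_pos) (auto intro: add_pos_nonneg)
    moreover have "2 / (2 * x) = 1 / x" for x :: real by simp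
    then have "2 / (2 * (real (Suc M) * q + q')) = 1 / (real (Suc M) * q + q')" .
    ultimately show ?thesis using bds by (intro mult_left_mono) auto
  qed
  also have "1 / q * (1 / (q + q') - 2 / ((real M + 1) * (q + q'))) = cyl h * (1 - 2 / (real M + 1))"
    by (simp add: cyl_eq[OF q] right_diff_distrib mult_ac)
  finally show ?thesis .
qed

lemma sum_cyl_powr_ge:
  assumes h: "\<And>b. b \<in> set h \<Longrightarrow> b > 0" and s: "s < 1"
  shows "(\<Sum>b=1..M. cyl (h @ [b]) powr s) \<ge> cyl h powr s * (2 powr (1 - s) * (1 - 2 / (real M + 1)))"
proof -
  have Z: "cyl h > 0" using h by (rule cyl_pos)
  have "cyl h powr s * (2 powr (1 - s) * (1 - 2 / (real M + 1)))
      = (cyl h / 2) powr (s - 1) * (cyl h * (1 - 2 / (real M + 1)))"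
  proof -
    have "cyl h powr s * 2 powr (1 - s) = (cyl h / 2) powr (s - 1) * cyl h"
      using Z by (simp add: powr_divide powr_diff)
    then show ?thesis by (simp only: mult.assoc[symmetric])
  qed
  also have "\<dots> \<le> (cyl h / 2) powr (s - 1) * (\<Sum>b=1..M. cyl (h @ [b]))"
    using h by (intro mult_left_mono sum_cyl_snoc) auto
  also have "\<dots> = (\<Sum>b=1..M. (cyl h / 2) powr (s - 1) * cyl (h @ [b]))"
    by (simp add: sum_distrib_left)
  also have "\<dots> \<le> (\<Sum>b=1..M. cyl (h @ [b]) powr s)"
  proof (intro sum_mono)
    fix b assume b: "b \<in> {1..M}"
    have pos: "cyl (h @ [b]) > 0" using h b by (intro cyl_pos) auto
    \<comment> \<open>The exponent \<open>s - 1\<close> is negative, so the shorter length has the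
      larger power.\<close>
    have "(cyl h / 2) powr (s - 1) \<le> cyl (h @ [b]) powr (s - 1)"
      using cyl_snoc_le_half[of h b] h b pos s by (intro powr_mono2') auto
    then have "(cyl h / 2) powr (s - 1) * cyl (h @ [b]) \<le> cyl (h @ [b]) powr (s - 1) * cyl (h @ [b])"
      using pos by (intro mult_right_mono) auto
    also have "\<dots> = cyl (h @ [b]) powr s"
      using pos by (simp add: powr_diff)
    finally show "(cyl h / 2) powr (s - 1) * cyl (h @ [b]) \<le> cyl (h @ [b]) powr s" .
  qed
  finally show ?thesis .
qed

text \<open>\<open>2 powr (1 - s)\<close> exceeds 1 and the other factor tends to 1, so the midpoint
  of 1 and \<open>2 powr (1 - s)\<close> can serve as \<open>C\<close>, the gain per free
  digit.\<close>

lemma ex_gain: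
  fixes s :: real
  assumes "s < 1"
  shows "\<exists>M C. M \<ge> 1 \<and> C > 1 \<and> 2 powr (1 - s) * (1 - 2 / (real M + 1)) \<ge> C"
proof -
  define c where "c = (2::real) powr (1 - s)"
  have c: "c > 1" unfolding c_def using assms by (intro gr_one_powr) auto
  have "(\<lambda>M. c * (1 - 2 / (real M + 1))) \<longlonglongrightarrow> c * (1 - 0)"
    by (intro tendsto_intros) real_asymp
  then have "eventually (\<lambda>M. c * (1 - 2 / (real M + 1)) > (1 + c) / 2) sequentially"
    by (rule order_tendstoD) (use c in simp)
  then have "eventually (\<lambda>M. M \<ge> 1 \<and> c * (1 - 2 / (real M + 1)) > (1 + c) / 2) sequentially"
    using eventually_ge_at_top[of 1] by eventually_elim auto
  then obtain M where "M \<ge> 1" "c * (1 - 2 / (real M + 1)) > (1 + c) / 2"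
    using eventually_happens'[OF sequentially_bot] by blast
  then show ?thesis
    using c by (intro exI[of _ M] exI[of _ "(1 + c) / 2"]) (auto simp flip: c_def)
qed

text \<open>A fixed prefix maps tails to values by a Moebius map of determinant plus or minus 1;
  this is its distance formula. Induction on the prefix length involves the denominators
  only.\<close>

lemma cf_val_diff:
  assumes pos: "\<And>i. d i > 0" "\<And>i. e i > 0" and "\<forall>i<n. d i = e i"
    and q: "denoms (map d [0..<n]) = (q, q')"
  shows "\<bar>cf_val d - cf_val e\<bar> = \<bar>cf_val (\<lambda>i. d (i + n)) - cf_val (\<lambda>i. e (i + n))\<bar> /
    ((q + cf_val (\<lambda>i. d (i + n)) * q') * (q + cf_val (\<lambda>i. e (i + n)) * q'))"
  using assms(3) q
proof (induction n arbitrary: q q')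
  case (Suc n)
  obtain r r' where r: "denoms (map d [0..<n]) = (r, r')" by fastforce
  have q: "q = real (d n) * r + r'" "q' = r"
    using denoms_snoc[OF r, of "d n"] Suc.prems by auto
  have rb: "1 \<le> r" "0 \<le> r'" using denoms_bounds[OF r] pos by auto
  define x where "x = cf_val (\<lambda>i. d (i + Suc n))"
  define y where "y = cf_val (\<lambda>i. e (i + Suc n))"
  have xy: "x > 0" "y > 0"
    using cf_val_strict_bounds pos by (auto simp: x_def y_def)
  define a where "a = real (d n)"
  have a: "a > 0" using pos by (simp add: a_def)
  have xn: "cf_val (\<lambda>i. d (i + n)) = 1 / (a + x)"
    using cf_val_rec[of "\<lambda>i. d (i + n)"] pos by (simp add: x_def a_def)
  have yn: "cf_val (\<lambda>i. e (i + n)) = 1 / (a + y)"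
    using cf_val_rec[of "\<lambda>i. e (i + n)"] pos Suc.prems by (simp add: y_def a_def)
  have eq: "r + 1 / (a + z) * r' = (q + z * q') / (a + z)" if "z > 0" for z
    using a that by (simp add: q a_def[symmetric] field_simps)
  have "\<bar>cf_val d - cf_val e\<bar> = \<bar>1 / (a + x) - 1 / (a + y)\<bar> /
      ((r + 1 / (a + x) * r') * (r + 1 / (a + y) * r'))"
    using Suc.IH[OF _ r] Suc.prems unfolding xn yn by simp
  also have "\<bar>1 / (a + x) - 1 / (a + y)\<bar> = \<bar>x - y\<bar> / ((a + x) * (a + y))"
  proof -
    have "1 / (a + x) - 1 / (a + y) = (y - x) / ((a + x) * (a + y))"
      using a xy by (simp add: field_simps)
    then show ?thesis using a xy by (simp add: abs_mult abs_minus_commute)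
  qed
  also have "\<bar>x - y\<bar> / ((a + x) * (a + y)) / ((r + 1 / (a + x) * r') * (r + 1 / (a + y) * r'))
      = \<bar>x - y\<bar> / ((q + x * q') * (q + y * q'))"
    unfolding eq[OF xy(1)] eq[OF xy(2)] using a xy by simp
  finally show ?case by (simp add: x_def y_def)
qed (simp add: denoms_Nil)

text \<open>Tails are below 1, so both factors of the denominator are at most \<open>q + q'\<close>,
  and one of these bounds is weakened to \<open>2 * q\<close>.\<close>

lemma cf_val_diff_ge:
  assumes pos: "\<And>i. d i > 0" "\<And>i. e i > 0" and eq: "\<forall>i<n. d i = e i"
  shows "\<bar>cf_val d - cf_val e\<bar> \<ge>
    \<bar>cf_val (\<lambda>i. d (i + n)) - cf_val (\<lambda>i. e (i + n))\<bar> * cyl (map d [0..<n]) / 2"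
proof -
  obtain q q' where q: "denoms (map d [0..<n]) = (q, q')" by fastforce
  have bds: "1 \<le> q" "0 \<le> q'" "q' \<le> q" using denoms_bounds[OF q] pos by auto
  define x where "x = cf_val (\<lambda>i. d (i + n))"
  define y where "y = cf_val (\<lambda>i. e (i + n))"
  have xy: "0 < x" "x < 1" "0 < y" "y < 1"
    using cf_val_strict_bounds pos by (auto simp: x_def y_def)
  have le: "q + z * q' \<le> q + q'" if "0 < z" "z < 1" for z
    using bds that mult_right_mono[of z 1 q'] by auto
  have "(q + x * q') * (q + y * q') \<le> (2 * q) * (q + q')"
    using le[of x] le[of y] xy bds by (intro mult_mono) auto
  then have "\<bar>x - y\<bar> / ((2 * q) * (q + q')) \<le> \<bar>x - y\<bar> / ((q + x * q') * (q + y * q'))"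
    using xy bds by (intro divide_left_mono mult_pos_pos) (auto intro!: add_pos_nonneg)
  then show ?thesis
    using cf_val_diff[OF pos eq q] by (simp add: x_def y_def cyl_eq[OF q] mult_ac)
qed

text \<open>
  For consecutive first digits, the second digit keeps the points away from the common endpoint:
  a bounded one by a lower bound on the tail of \<open>e\<close>, one that is shared and at least 2 by an upper
  bound on the tail of \<open>d\<close>.
\<close>

lemma cf_val_first_digit_gap:
  assumes pos: "\<And>i. d i > 0" "\<And>i. e i > 0" and "d 0 < e 0" "e 0 \<le> M"
    and second: "e 1 \<le> M \<or> d 1 \<ge> 2"
  shows "cf_val d - cf_val e \<ge> 1 / (real M + 1) ^ 3"
proof -
  define x where "x = cf_val (\<lambda>i. d (Suc i))"
  define y where "y = cf_val (\<lambda>i. e (Suc i))"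
  have xy: "0 < x" "x < 1" "0 < y" "y < 1"
    using cf_val_strict_bounds pos by (auto simp: x_def y_def)
  have M: "real M \<ge> 1" using assms by linarith
  define a where "a = real (d 0)"
  define b where "b = real (e 0)"
  have ab: "1 \<le> a" "a + 1 \<le> b" "b \<le> real M"
    using pos(1)[of 0] assms(3,4) unfolding a_def b_def by linarith+
  have "1 - x + y \<ge> 1 / (real M + 1)"
    using second
  proof
    assume le: "e 1 \<le> M"
    define y' where "y' = cf_val (\<lambda>i. e (Suc (Suc i)))"
    have "y = 1 / (real (e 1) + y')"
      using cf_val_rec[of "\<lambda>i. e (Suc i)"] pos by (simp add: y_def y'_def)
    moreover have "0 < y'" "y' < 1"
      using cf_val_strict_bounds[of "\<lambda>i. e (Suc (Suc i))"] pos by (auto simp: y'_def)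
    ultimately have "y \<ge> 1 / (real M + 1)"
      using le by (auto intro!: divide_left_mono mult_pos_pos)
    then show ?thesis using xy by linarith
  next
    assume ge: "d 1 \<ge> 2"
    define x' where "x' = cf_val (\<lambda>i. d (Suc (Suc i)))"
    have "x = 1 / (real (d 1) + x')"
      using cf_val_rec[of "\<lambda>i. d (Suc i)"] pos by (simp add: x_def x'_def)
    moreover have "0 < x'"
      using cf_val_strict_bounds[of "\<lambda>i. d (Suc (Suc i))"] pos by (auto simp: x'_def)
    ultimately have "x \<le> 1 / 2"
      using ge by (auto intro!: divide_left_mono mult_pos_pos)
    moreover have "1 / (real M + 1) \<le> 1 / 2"
      using M by (intro divide_left_mono) auto
    ultimately show ?thesis using xy by linarith
  qed
  then have gap: "1 / (real M + 1) \<le> b + y - (a + x)" using ab by linarith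
  \<comment> \<open>One factor \<open>M + 1\<close> comes from the gap, the other two bound
    \<open>a + x\<close> and \<open>b + y\<close>.\<close>
  have "1 / (real M + 1) ^ 3 = 1 / (real M + 1) / ((real M + 1) * (real M + 1))"
    by (simp add: power3_eq_cube)
  also have "\<dots> \<le> (b + y - (a + x)) / ((real M + 1) * (real M + 1))"
    using gap M by (intro divide_right_mono) auto
  also have "\<dots> \<le> (b + y - (a + x)) / ((a + x) * (b + y))"
  proof (intro divide_left_mono mult_mono)
    show "0 \<le> b + y - (a + x)"
      using gap M by (intro order_trans[OF _ gap]) auto
  qed (use xy ab in auto)
  also have "\<dots> = 1 / (a + x) - 1 / (b + y)"
    using xy ab by (simp add: field_simps)
  also have "\<dots> = cf_val d - cf_val e"
    using cf_val_rec[of d] cf_val_rec[of e] pos by (simp add: a_def b_def x_def y_def)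
  finally show ?thesis .
qed

subsection \<open>Bounded digits with sparse prescribed digits\<close>

text \<open>In what follows \<open>D i = 0\<close> marks a free digit in \<open>{1..M}\<close>, other values of \<open>D\<close> are prescribed.\<close>

definition digit_choices :: "(nat \<Rightarrow> nat) \<Rightarrow> nat \<Rightarrow> nat \<Rightarrow> nat set" where
  "digit_choices D M n = (if D n = 0 then {1..M} else {D n})"

lemma digit_choices_pos: "b \<in> digit_choices D M n \<Longrightarrow> b > 0"
  by (auto simp: digit_choices_def split: if_splits)

text \<open>Digits can first differ only at a free position, so both are at most \<open>M\<close>
  there. The next position is free or carries a shared prescribed digit, at least 2 by the
  hypothesis on \<open>D\<close>; so the gap for first digits applies to the tails.\<close>

lemma cf_val_separation:
  assumes d: "\<And>i. d i \<in> digit_choices D M i" and e: "\<And>i. e i \<in> digit_choices D M i"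
    and D: "\<And>i. D i \<noteq> 1" and eq: "\<forall>i<n. d i = e i" and neq: "d n \<noteq> e n"
  shows "cyl (map d [0..<n]) \<le> 2 * (real M + 1) ^ 3 * \<bar>cf_val d - cf_val e\<bar>"
proof -
  have pos: "d i > 0" "e i > 0" for i
    using d e digit_choices_pos by blast+
  have gap: "cf_val (\<lambda>i. d (i + n)) - cf_val (\<lambda>i. e (i + n)) \<ge> 1 / (real M + 1) ^ 3"
    if d: "\<And>i. d i \<in> digit_choices D M i" and e: "\<And>i. e i \<in> digit_choices D M i"
      and less: "d n < e n" for d e
  proof (rule cf_val_first_digit_gap)
    have "D n = 0"
      using d[of n] e[of n] less by (auto simp: digit_choices_def split: if_splits)
    then show "e (0 + n) \<le> M"
      using e[of n] by (auto simp: digit_choices_def)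
    show "e (1 + n) \<le> M \<or> 2 \<le> d (1 + n)"
      using d[of "1 + n"] e[of "1 + n"] D[of "1 + n"]
      by (auto simp: digit_choices_def split: if_splits)
    show "d (i + n) > 0" "e (i + n) > 0" for i
      using d e digit_choices_pos by blast+
  qed (use less in simp)
  have "1 / (real M + 1) ^ 3 \<le> \<bar>cf_val (\<lambda>i. d (i + n)) - cf_val (\<lambda>i. e (i + n))\<bar>"
  proof (cases "d n < e n")
    case True
    show ?thesis using gap[OF d e True] by simp
  next
    case False
    then have "e n < d n" using neq by simp
    show ?thesis using gap[OF e d \<open>e n < d n\<close>] by simp
  qed
  moreover have cyl: "cyl (map d [0..<n]) > 0"
    using pos by (intro cyl_pos) auto
  ultimately have "1 / (real M + 1) ^ 3 * cyl (map d [0..<n]) / 2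
      \<le> \<bar>cf_val (\<lambda>i. d (i + n)) - cf_val (\<lambda>i. e (i + n))\<bar> * cyl (map d [0..<n]) / 2"
    by (intro divide_right_mono mult_right_mono) auto
  also have "\<dots> \<le> \<bar>cf_val d - cf_val e\<bar>"
    by (rule cf_val_diff_ge) (use pos eq in auto)
  finally show ?thesis by (simp add: field_simps)
qed

text \<open>The weights give a cylinder mass at most \<open>K\<close> times the power
  \<open>s\<close> of its length, where \<open>K\<close> bounds the accumulated costs and gains.
  With \<open>cf_val_separation\<close>, the coding satisfies the expansion condition of
  \<open>hausdorff_measure_nonzero\<close>.\<close>

lemma hausdorff_measure_digits_nonzero:
  assumes s: "0 < s" "s < 1" and M: "M \<ge> 1" and C: "C > 1"
    and gain: "2 powr (1 - s) * (1 - 2 / (real M + 1)) \<ge> C"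
    and D: "\<And>i. D i \<noteq> 1"
    and K: "\<And>n. (\<Prod>i<n. if D i = 0 then 1 / C else (real (D i) + 1)\<^sup>2) \<le> K"
  shows "hausdorff_measure s {cf_val d |d. \<forall>i. d i \<in> digit_choices D M i} \<noteq> 0"
proof -
  define S where "S = (\<lambda>h::nat list. digit_choices D M (length h))"
  define W where "W = (\<lambda>h. \<Sum>b\<in>S h. cyl (h @ [b]) powr s)"
  define good where "good = (\<lambda>h::nat list. \<forall>b\<in>set h. b > 0)"
  \<comment> \<open>Words containing 0 never arise from allowed digits; uniform weights there only
    ensure that the weights add up to 1 for every word.\<close>
  define p where "p = (\<lambda>h b. if good h then cyl (h @ [b]) powr s / W h else 1 / real (card (S h)))"
  define \<beta> where "\<beta> = (\<lambda>i. if D i = 0 then 1 / C else (real (D i) + 1)\<^sup>2)"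
  have S: "finite (S h)" "S h \<noteq> {}" for h
    using M by (auto simp: S_def digit_choices_def)
  have cyl: "cyl (h @ [b]) > 0" if "good h" "b \<in> S h" for h b
    using that digit_choices_pos by (intro cyl_pos) (auto simp: good_def S_def)
  have W: "W h > 0" if "good h" for h
    unfolding W_def using S cyl[OF that] by (intro sum_pos) (auto simp: less_imp_neq[symmetric])
  have \<beta>: "\<beta> i > 0" for i using C by (auto simp: \<beta>_def)
  \<comment> \<open>\<open>\<beta>\<close> compares mass with length to the power \<open>s\<close>
    in one step: a free digit gains as \<open>W h \<ge> C * cyl h powr s\<close>, a prescribed one
    keeps all the mass while the length shrinks.\<close>
  have step: "p h b * cyl h powr s \<le> cyl (h @ [b]) powr s * \<beta> (length h)"
    if h: "good h" and b: "b \<in> S h" for h b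
  proof (cases "D (length h) = 0")
    case True
    then have "W h = (\<Sum>b=1..M. cyl (h @ [b]) powr s)"
      by (simp add: W_def S_def digit_choices_def)
    also have "\<dots> \<ge> cyl h powr s * (2 powr (1 - s) * (1 - 2 / (real M + 1)))"
      using h s by (intro sum_cyl_powr_ge) (auto simp: good_def)
    finally have "cyl h powr s * (2 powr (1 - s) * (1 - 2 / (real M + 1))) \<le> W h" .
    moreover have "cyl h powr s * C \<le> cyl h powr s * (2 powr (1 - s) * (1 - 2 / (real M + 1)))"
      using gain by (intro mult_left_mono) auto
    ultimately have "cyl h powr s * C \<le> W h"
      by linarith
    then have le: "cyl h powr s \<le> W h / C"
      using C by (simp add: field_simps)
    have "p h b * cyl h powr s \<le> p h b * (W h / C)"
      using le W[OF h] h by (intro mult_left_mono) (auto simp: p_def)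
    also have "\<dots> = cyl (h @ [b]) powr s * \<beta> (length h)"
      using W[OF h] h True by (simp add: p_def \<beta>_def)
    finally show ?thesis .
  next
    case False
    then have Sh: "S h = {D (length h)}" by (simp add: S_def digit_choices_def)
    then have bD: "b = D (length h)" using b by simp
    have "p h b = 1"
      using W[OF h] h by (simp add: p_def W_def Sh bD)
    have hpos: "cyl h > 0" using h by (intro cyl_pos) (auto simp: good_def)
    have "cyl h \<le> cyl (h @ [b]) * (real b + 1)\<^sup>2"
      using h False bD by (intro cyl_snoc_ge) (auto simp: good_def)
    then have "cyl h powr s \<le> (cyl (h @ [b]) * (real b + 1)\<^sup>2) powr s"
      using hpos s by (intro powr_mono2) auto
    also have "\<dots> = cyl (h @ [b]) powr s * ((real b + 1)\<^sup>2) powr s"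
      using cyl[OF h b] by (simp add: powr_mult)
    also have "\<dots> \<le> cyl (h @ [b]) powr s * ((real b + 1)\<^sup>2) powr 1"
      using s by (intro mult_left_mono powr_mono) auto
    finally show ?thesis using \<open>p h b = 1\<close> False bD by (simp add: \<beta>_def)
  qed
  have p1: "sum (p h) (S h) = 1" for h
  proof (cases "good h")
    case True
    then have "sum (p h) (S h) = W h / W h"
      by (simp only: p_def W_def if_True sum_divide_distrib)
    then show ?thesis using W[OF True] by simp
  next
    case False
    then show ?thesis using S[of h] by (simp add: p_def)
  qed
  have p0: "p h b \<ge> 0" for h b
    by (auto simp: p_def W_def intro!: divide_nonneg_nonneg sum_nonneg)
  obtain d where
    d: "\<forall>u\<in>{0..<1}. \<forall>n. d u n \<in> S (map (d u) [0..<n])" and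
    close: "\<forall>u\<in>{0..<1}. \<forall>v\<in>{0..<1}. \<forall>n. (\<forall>i<n. d u i = d v i) \<longrightarrow>
       \<bar>u - v\<bar> \<le> (\<Prod>i<n. p (map (d u) [0..<i]) (d u i))"
    using tree_coding[of S p, OF S(1) p1 p0] by (elim exE conjE)
  have dch: "d u n \<in> digit_choices D M n" if "u \<in> {0..<1}" for u n
    using bspec[OF d that, THEN spec, of n] by (simp add: S_def)
  have good: "good (map (d u) [0..<n])" if "u \<in> {0..<1}" for u n
    using digit_choices_pos[OF dch[OF that]] by (auto simp: good_def)
  have cyl_d: "0 < cyl (map (d u) [0..<n])" "cyl (map (d u) [0..<n]) \<le> (1 / 2) ^ n"
    if "u \<in> {0..<1}" for u n
  proof -
    have pos: "b > 0" if "b \<in> set (map (d u) [0..<n])" for b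
      using good[OF \<open>u \<in> {0..<1}\<close>, of n] that unfolding good_def by blast
    show "0 < cyl (map (d u) [0..<n])" by (rule cyl_pos[OF pos])
    show "cyl (map (d u) [0..<n]) \<le> (1 / 2) ^ n"
      using cyl_le[of "map (d u) [0..<n]", OF pos] by (simp only: length_map length_upt diff_zero)
  qed
  have pi: "(\<Prod>i<n. p (map (d u) [0..<i]) (d u i)) \<le> cyl (map (d u) [0..<n]) powr s * (\<Prod>i<n. \<beta> i)"
    if u: "u \<in> {0..<1}" for u n
  proof (induction n)
    case 0
    show ?case by (simp add: cyl_def denoms_Nil)
  next
    case (Suc n)
    let ?h = "map (d u) [0..<n]"
    have "(\<Prod>i<Suc n. p (map (d u) [0..<i]) (d u i)) \<le> (cyl ?h powr s * (\<Prod>i<n. \<beta> i)) * p ?h (d u n)"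
      using Suc p0 by (simp add: mult_right_mono)
    also have "\<dots> = (p ?h (d u n) * cyl ?h powr s) * (\<Prod>i<n. \<beta> i)" by simp
    also have "\<dots> \<le> (cyl (?h @ [d u n]) powr s * \<beta> (length ?h)) * (\<Prod>i<n. \<beta> i)"
      using \<beta> by (intro mult_right_mono step good u d[rule_format] prod_nonneg) (auto simp: less_imp_le)
    also have "\<dots> = cyl (map (d u) [0..<Suc n]) powr s * (\<Prod>i<Suc n. \<beta> i)"
      by simp
    finally show ?case .
  qed
  have K0: "K \<ge> 1" using K[of 0] by simp
  have bound: "\<bar>u - v\<bar> \<le> K * cyl (map (d u) [0..<n]) powr s"
    if "u \<in> {0..<1}" "v \<in> {0..<1}" "\<forall>i<n. d u i = d v i" for u v n
  proof -
    have "\<bar>u - v\<bar> \<le> cyl (map (d u) [0..<n]) powr s * (\<Prod>i<n. \<beta> i)"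
      using bspec[OF bspec[OF close that(1)] that(2), THEN spec, THEN mp, OF that(3)] pi[OF that(1), of n]
      by linarith
    also have "\<dots> \<le> cyl (map (d u) [0..<n]) powr s * K"
      using K[of n] by (intro mult_left_mono) (auto simp: \<beta>_def)
    finally show ?thesis by (simp add: mult.commute)
  qed
  define L where "L = 2 * (real M + 1) ^ 3"
  have L: "L > 0" by (simp add: L_def)
  show ?thesis
  proof (rule hausdorff_measure_nonzero[of s "K * L powr s" "\<lambda>u. cf_val (d u)"])
    show "K * L powr s > 0" using K0 L by simp
    show "cf_val (d u) \<in> {cf_val d |d. \<forall>i. d i \<in> digit_choices D M i}" if "u \<in> {0..<1}" for u
      using dch[OF that] by blast
    fix u v :: real assume uv: "u \<in> {0..<1}" "v \<in> {0..<1}"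
    show "\<bar>u - v\<bar> \<le> K * L powr s * dist (cf_val (d u)) (cf_val (d v)) powr s"
    proof (cases "\<forall>n. d u n = d v n")
      case True
      \<comment> \<open>Identical digit sequences force \<open>u = v\<close>, since the common
        cylinders shrink to length 0.\<close>
      have "\<bar>u - v\<bar> \<le> K * ((1 / 2) ^ n) powr s" for n
      proof -
        have "\<bar>u - v\<bar> \<le> K * cyl (map (d u) [0..<n]) powr s"
          using bound[OF uv, of n] True by simp
        also have "\<dots> \<le> K * ((1 / 2) ^ n) powr s"
          using cyl_d[OF uv(1), of n] K0 s by (intro mult_left_mono powr_mono2) auto
        finally show ?thesis .
      qed
      moreover have "(\<lambda>n. K * ((1 / 2) ^ n) powr s) \<longlonglongrightarrow> 0"
        using s by real_asymp
      ultimately have "\<bar>u - v\<bar> \<le> 0"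
        by (intro LIMSEQ_le_const) auto
      also have "0 \<le> K * L powr s * dist (cf_val (d u)) (cf_val (d v)) powr s"
        using K0 by simp
      finally show ?thesis .
    next
      case False
      define n where "n = (LEAST n. d u n \<noteq> d v n)"
      have neq: "d u n \<noteq> d v n" unfolding n_def using False by (metis (mono_tags) LeastI)
      have eq: "\<forall>i<n. d u i = d v i"
        using not_less_Least unfolding n_def by blast
      have "cyl (map (d u) [0..<n]) \<le> L * dist (cf_val (d u)) (cf_val (d v))"
        unfolding L_def dist_real_def
        by (rule cf_val_separation[OF dch[OF uv(1)] dch[OF uv(2)] D eq neq])
      then have "cyl (map (d u) [0..<n]) powr s \<le> (L * dist (cf_val (d u)) (cf_val (d v))) powr s"
        using cyl_d(1)[OF uv(1), of n] s by (intro powr_mono2) auto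
      also have "\<dots> = L powr s * dist (cf_val (d u)) (cf_val (d v)) powr s"
        using L by (simp add: powr_mult)
      finally have "K * cyl (map (d u) [0..<n]) powr s
          \<le> K * (L powr s * dist (cf_val (d u)) (cf_val (d v)) powr s)"
        using K0 by (intro mult_left_mono) auto
      then show ?thesis using bound[OF uv eq] by (simp add: mult.assoc)
    qed
  qed (rule s)
qed

subsection \<open>The growth function\<close>

text \<open>With \<open>n = 2 ^ k\<close> this is
  \<open>n powr \<beta> + (log 2 n)\<^sup>2\<close>.\<close>

definition growth_exp :: "real \<Rightarrow> nat \<Rightarrow> real" where
  "growth_exp \<beta> k = 2 powr (real k * \<beta>) + (real k)\<^sup>2"

text \<open>Constant on dyadic blocks; the summand \<open>k\<^sup>2\<close> makes it superlinear also for \<open>\<beta> = 0\<close>.\<close>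

definition growth :: "real \<Rightarrow> nat \<Rightarrow> real" where
  "growth \<beta> n = exp (growth_exp \<beta> (floor_log n))"

lemma growth_pos: "growth \<beta> n > 0"
  by (simp add: growth_def)

lemma growth_exp_mono: "\<beta> \<ge> 0 \<Longrightarrow> j \<le> k \<Longrightarrow> growth_exp \<beta> j \<le> growth_exp \<beta> k"
  unfolding growth_exp_def by (intro add_mono powr_mono power_mono mult_right_mono) auto

lemma growth_mono: "\<beta> \<ge> 0 \<Longrightarrow> m \<le> n \<Longrightarrow> growth \<beta> m \<le> growth \<beta> n"
  unfolding growth_def by (simp add: growth_exp_mono floor_log_le_iff)

lemma growth_exp_ge_1: "\<beta> \<ge> 0 \<Longrightarrow> growth_exp \<beta> k \<ge> 1"
  using growth_exp_mono[of \<beta> 0 k] by (simp add: growth_exp_def)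

lemma filterlim_floor_log: "filterlim floor_log at_top at_top"
  unfolding filterlim_at_top
proof
  fix k
  show "eventually (\<lambda>n. k \<le> floor_log n) at_top"
    using eventually_ge_at_top[of "2 ^ k"]
  proof eventually_elim
    case (elim n)
    then show ?case using floor_log_le_iff[of "2 ^ k" n] by simp
  qed
qed

text \<open>As \<open>2 powr (k * \<beta>) \<ge> 1\<close>, the exponent lies between this power and
  its product with \<open>1 + k\<^sup>2\<close>, a factor whose logarithm is
  \<open>o(k)\<close>.\<close>

lemma ln_growth_exp_limit:
  assumes "\<beta> \<ge> 0"
  shows "(\<lambda>k. ln (growth_exp \<beta> k) / (real k * ln 2)) \<longlonglongrightarrow> \<beta>"
proof (rule tendsto_sandwich)
  show "eventually (\<lambda>k. \<beta> \<le> ln (growth_exp \<beta> k) / (real k * ln 2)) sequentially"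
    using eventually_gt_at_top[of 0]
  proof eventually_elim
    case (elim k)
    have "real k * \<beta> * ln 2 = ln (2 powr (real k * \<beta>))" by (simp add: ln_powr)
    also have "\<dots> \<le> ln (growth_exp \<beta> k)"
      by (subst ln_le_cancel_iff) (auto simp: growth_exp_def intro!: add_pos_nonneg)
    finally show ?case using elim by (simp add: field_simps)
  qed
  show "eventually (\<lambda>k. ln (growth_exp \<beta> k) / (real k * ln 2)
      \<le> \<beta> + ln (1 + (real k)\<^sup>2) / (real k * ln 2)) sequentially"
    using eventually_gt_at_top[of 0]
  proof eventually_elim
    case (elim k)
    have "1 * (real k)\<^sup>2 \<le> 2 powr (real k * \<beta>) * (real k)\<^sup>2"
      using assms by (intro mult_right_mono ge_one_powr_ge_zero) auto
    then have "growth_exp \<beta> k \<le> 2 powr (real k * \<beta>) * (1 + (real k)\<^sup>2)"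
      by (simp add: growth_exp_def algebra_simps)
    then have "ln (growth_exp \<beta> k) \<le> ln (2 powr (real k * \<beta>) * (1 + (real k)\<^sup>2))"
      using growth_exp_ge_1[OF assms, of k]
      by (subst ln_le_cancel_iff) (auto intro!: mult_pos_pos add_pos_nonneg)
    also have "\<dots> = real k * \<beta> * ln 2 + ln (1 + (real k)\<^sup>2)"
    proof -
      have "0 < 1 + (real k)\<^sup>2" by (simp add: add_pos_nonneg)
      then show ?thesis by (subst ln_mult) (auto simp: ln_powr)
    qed
    finally show ?case using elim by (simp add: field_simps)
  qed
  have "(\<lambda>k. ln (1 + (real k)\<^sup>2) / (real k * ln 2)) \<longlonglongrightarrow> 0"
    by real_asymp
  then show "(\<lambda>k. \<beta> + ln (1 + (real k)\<^sup>2) / (real k * ln 2)) \<longlonglongrightarrow> \<beta>"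
    using tendsto_add[OF tendsto_const[of \<beta>]] by fastforce
qed auto

text \<open>On a block the numerator is constant and \<open>ln n\<close> is least at the left end
  \<open>2 ^ k\<close>, so the quotients there dominate; along this subsequence they converge to
  \<beta>.\<close>

lemma limsup_growth:
  assumes "\<beta> \<ge> 0"
  shows "limsup (\<lambda>n. ereal (ln (ln (growth \<beta> n)) / ln (real n))) = ereal \<beta>"
proof (rule antisym)
  let ?g = "\<lambda>k. ln (growth_exp \<beta> k) / (real k * ln 2)"
  let ?f = "\<lambda>n. ereal (ln (ln (growth \<beta> n)) / ln (real n))"
  have lim: "(\<lambda>n. ereal (?g (floor_log n))) \<longlonglongrightarrow> ereal \<beta>"
    using filterlim_compose[OF ln_growth_exp_limit[OF assms] filterlim_floor_log] by simp
  have "eventually (\<lambda>n. ?f n \<le> ereal (?g (floor_log n))) sequentially"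
    using eventually_ge_at_top[of 2]
  proof eventually_elim
    case (elim n)
    then have k: "floor_log n > 0" using floor_log_le_iff[of 2 n] floor_log_power[of 1] by simp
    have "real (2 ^ floor_log n) \<le> real n"
      using floor_log_exp2_le[of n] elim by (simp only: of_nat_le_iff)
    then have "ln (2 ^ floor_log n) \<le> ln (real n)"
      using elim by (subst ln_le_cancel_iff) auto
    then have "real (floor_log n) * ln 2 \<le> ln (real n)"
      by (simp add: ln_realpow)
    \<comment> \<open>The sign matters: a larger denominator lowers the quotient only if the
      numerator is nonnegative.\<close>
    moreover have "ln (growth_exp \<beta> (floor_log n)) \<ge> 0"
      using growth_exp_ge_1[OF assms] by simp
    ultimately show ?case
      using k elim by (auto simp: growth_def intro!: divide_left_mono mult_pos_pos)
  qed
  then have "limsup ?f \<le> limsup (\<lambda>n. ereal (?g (floor_log n)))"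
    by (rule Limsup_mono)
  also have "\<dots> = ereal \<beta>"
    by (rule lim_imp_Limsup[OF sequentially_bot lim])
  finally show "limsup ?f \<le> ereal \<beta>" .
  have "(?f \<circ> (\<lambda>k. 2 ^ k)) = (\<lambda>k. ereal (?g k))"
    by (auto simp: growth_def ln_realpow)
  then have "limsup (?f \<circ> (\<lambda>k. 2 ^ k)) = ereal \<beta>"
    using ln_growth_exp_limit[OF assms] by (simp add: lim_imp_Limsup)
  then show "ereal \<beta> \<le> limsup ?f"
    using limsup_subseq_mono[of "\<lambda>k. 2 ^ k" ?f] by (simp add: strict_mono_def)
qed

text \<open>Adding 2 keeps the digit away from 0, the marker of free positions, and from 1, which
  \<open>cf_val_separation\<close> excludes.\<close>

definition large_digit :: "real \<Rightarrow> real \<Rightarrow> nat \<Rightarrow> nat" where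
  "large_digit \<alpha> \<beta> k = nat \<lfloor>\<alpha> * exp (growth_exp \<beta> k)\<rfloor> + 2"

text \<open>Partial quotient number \<open>2\<^sup>k\<close> has index \<open>2\<^sup>k - 1\<close> here, since digit sequences start at 0.\<close>

definition prescribed :: "real \<Rightarrow> real \<Rightarrow> nat \<Rightarrow> nat" where
  "prescribed \<alpha> \<beta> i =
     (if Suc i = 2 ^ floor_log (Suc i) then large_digit \<alpha> \<beta> (floor_log (Suc i)) else 0)"

lemma prescribed_neq_1: "prescribed \<alpha> \<beta> i \<noteq> 1"
  by (simp add: prescribed_def large_digit_def)

lemma prescribed_power: "prescribed \<alpha> \<beta> (2 ^ k - 1) = large_digit \<alpha> \<beta> k"
  by (simp add: prescribed_def)

lemma prescribed_between:
  assumes "2 ^ k \<le> i" "Suc i < 2 ^ Suc k"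
  shows "prescribed \<alpha> \<beta> i = 0"
proof -
  have "floor_log (Suc i) = k"
    using assms by (intro floor_log_eqI) auto
  then show ?thesis using assms by (simp add: prescribed_def)
qed

lemma large_digit_bounds:
  assumes "\<alpha> > 0"
  shows "\<alpha> * exp (growth_exp \<beta> k) \<le> real (large_digit \<alpha> \<beta> k)"
    "real (large_digit \<alpha> \<beta> k) \<le> \<alpha> * exp (growth_exp \<beta> k) + 2"
proof -
  have "0 \<le> \<alpha> * exp (growth_exp \<beta> k)" using assms by simp
  then show "\<alpha> * exp (growth_exp \<beta> k) \<le> real (large_digit \<alpha> \<beta> k)"
    "real (large_digit \<alpha> \<beta> k) \<le> \<alpha> * exp (growth_exp \<beta> k) + 2"
    unfolding large_digit_def by (auto simp: of_nat_nat) linarith+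
qed

lemma large_digit_mono:
  assumes "\<alpha> > 0" "\<beta> \<ge> 0" "j \<le> k"
  shows "large_digit \<alpha> \<beta> j \<le> large_digit \<alpha> \<beta> k"
  unfolding large_digit_def using assms
  by (intro add_mono nat_mono floor_mono mult_left_mono) (auto simp: growth_exp_mono)

lemma bounded_if_eventually_decreasing:
  fixes b :: "nat \<Rightarrow> real"
  assumes "eventually (\<lambda>k. b (Suc k) \<le> b k) sequentially"
  shows "\<exists>K. \<forall>k. b k \<le> K"
proof -
  obtain N where N: "\<And>k. k \<ge> N \<Longrightarrow> b (Suc k) \<le> b k"
    using assms by (auto simp: eventually_sequentially)
  have "b k \<le> Max (b ` {..N})" for k
  proof (induction k)
    case (Suc k)
    show ?case
    proof (cases "k \<ge> N")
      case True
      then show ?thesis using N[OF True] Suc by linarith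
    next
      case False
      then have "Suc k \<in> {..N}" by simp
      then show ?thesis by (intro Max_ge) blast+
    qed
  qed (intro Max_ge, auto)
  then show ?thesis by blast
qed

text \<open>Exactly \<open>2 ^ k - 1\<close> free positions lie between the indices
  \<open>2 ^ k - 1\<close> and \<open>2 ^ Suc k - 1\<close>. Their gain pays for the digit at the
  latter, since the logarithm of its cost is \<open>o(2 ^ k)\<close>; this is where
  \<open>\<beta> < 1\<close> enters.\<close>

lemma large_digit_subexponential:
  assumes "\<alpha> > 0" "0 \<le> \<beta>" "\<beta> < 1" "C > 1"
  shows "eventually (\<lambda>k. (real (large_digit \<alpha> \<beta> (Suc k)) + 1)\<^sup>2 \<le> C ^ (2 ^ k - 1)) sequentially"
proof -
  \<comment> \<open>A positive exponent below 1 covers \<open>\<beta> = 0\<close> and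
    \<open>\<beta> > 0\<close> in one limit.\<close>
  define \<gamma> where "\<gamma> = max \<beta> (1 / 2)"
  have \<gamma>: "\<gamma> > 0" "\<gamma> < 1" "\<beta> \<le> \<gamma>" using assms by (auto simp: \<gamma>_def)
  have lnC: "ln C > 0" using assms by simp
  have "(\<lambda>k. 2 * (ln (\<alpha> + 3) + 2 powr (real (Suc k) * \<gamma>) + (real (Suc k))\<^sup>2) / (2 ^ k - 1)) \<longlonglongrightarrow> 0"
    using \<gamma> by real_asymp
  then have "eventually (\<lambda>k. 2 * (ln (\<alpha> + 3) + 2 powr (real (Suc k) * \<gamma>) + (real (Suc k))\<^sup>2) / (2 ^ k - 1) < ln C) sequentially"
    using lnC by (rule order_tendstoD)
  then show ?thesis
    using eventually_gt_at_top[of 0]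
  proof eventually_elim
    case (elim k)
    let ?E = "exp (growth_exp \<beta> (Suc k))"
    have "(1::real) < 2 ^ k" using elim(2) by (intro one_less_power) auto
    then have le: "2 * (ln (\<alpha> + 3) + 2 powr (real (Suc k) * \<gamma>) + (real (Suc k))\<^sup>2) \<le> ln C * (2 ^ k - 1)"
      using elim(1) by (simp add: pos_divide_less_eq)
    have "2 powr (real (Suc k) * \<beta>) \<le> 2 powr (real (Suc k) * \<gamma>)"
      using \<gamma> by (intro powr_mono mult_left_mono) auto
    then have le2: "2 * (ln (\<alpha> + 3) + growth_exp \<beta> (Suc k)) \<le> ln C * (2 ^ k - 1)"
      unfolding growth_exp_def
      by (intro order_trans[OF _ le] mult_left_mono) (simp_all only: add.assoc add_left_mono add_right_mono zero_le_numeral)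
    have "?E \<ge> 1" using growth_exp_ge_1[OF assms(2), of "Suc k"] by simp
    then have "real (large_digit \<alpha> \<beta> (Suc k)) + 1 \<le> (\<alpha> + 3) * ?E"
      using large_digit_bounds(2)[OF assms(1), of \<beta> "Suc k"] unfolding distrib_right by linarith
    also have "\<dots> = exp (ln (\<alpha> + 3) + growth_exp \<beta> (Suc k))"
      using assms by (simp add: exp_add)
    finally have "(real (large_digit \<alpha> \<beta> (Suc k)) + 1)\<^sup>2
        \<le> (exp (ln (\<alpha> + 3) + growth_exp \<beta> (Suc k)))\<^sup>2"
      by (intro power_mono) auto
    also have "\<dots> = exp (2 * (ln (\<alpha> + 3) + growth_exp \<beta> (Suc k)))"
      by (simp add: power2_eq_square exp_add[symmetric])
    also have "\<dots> \<le> exp (ln C * (2 ^ k - 1))"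
      using le2 by simp
    also have "\<dots> = exp (real (2 ^ k - 1) * ln C)"
      by (simp add: of_nat_diff mult.commute)
    also have "\<dots> = C ^ (2 ^ k - 1)"
      by (subst exp_of_nat_mult) (use assms in simp)
    finally show ?case .
  qed
qed

text \<open>The product decreases within a block, and eventually also from one power of two to the
  next, so its values at the powers of two are bounded and control all others.\<close>

lemma prescribed_cost_bounded:
  assumes "\<alpha> > 0" "0 \<le> \<beta>" "\<beta> < 1" and C: "C > 1"
  shows "\<exists>K. \<forall>n. (\<Prod>i<n. if prescribed \<alpha> \<beta> i = 0 then 1 / C
    else (real (prescribed \<alpha> \<beta> i) + 1)\<^sup>2) \<le> K"
proof -
  define c where "c = (\<lambda>i. if prescribed \<alpha> \<beta> i = 0 then 1 / C
    else (real (prescribed \<alpha> \<beta> i) + 1)\<^sup>2)"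
  define B where "B = (\<lambda>n. \<Prod>i<n. c i)"
  have c0: "c i \<ge> 0" for i using C by (simp add: c_def)
  have B0: "B n \<ge> 0" for n unfolding B_def using c0 by (intro prod_nonneg) auto
  \<comment> \<open>\<open>B (2 ^ k)\<close> already contains the cost at index
    \<open>2 ^ k - 1\<close>, so only factors \<open>1 / C\<close> follow within the block.\<close>
  have block: "B n = B (2 ^ k) / C ^ (n - 2 ^ k)" if "2 ^ k \<le> n" "n < 2 ^ Suc k" for k n
    using that
  proof (induction n rule: dec_induct)
    case (step n)
    then have "c n = 1 / C"
      using prescribed_between[of k n] by (simp add: c_def)
    then have "B (Suc n) = B n / C" by (simp add: B_def)
    then show ?case using step by (simp add: Suc_diff_le)
  qed simp
  have next_block: "B (2 ^ Suc k) = B (2 ^ k) * ((real (large_digit \<alpha> \<beta> (Suc k)) + 1)\<^sup>2 / C ^ (2 ^ k - 1))" for k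
  proof -
    have "2 ^ Suc k = Suc (2 ^ Suc k - 1)" by simp
    then have "B (2 ^ Suc k) = B (2 ^ Suc k - 1) * c (2 ^ Suc k - 1)"
      unfolding B_def by (metis prod.lessThan_Suc)
    also have "B (2 ^ Suc k - 1) = B (2 ^ k) / C ^ (2 ^ Suc k - 1 - 2 ^ k)"
      by (rule block) auto
    also have "(2::nat) ^ Suc k - 1 - 2 ^ k = 2 ^ k - 1" by simp
    also have "c (2 ^ Suc k - 1) = (real (large_digit \<alpha> \<beta> (Suc k)) + 1)\<^sup>2"
      unfolding c_def prescribed_power by (simp add: large_digit_def)
    finally show ?thesis by simp
  qed
  have "eventually (\<lambda>k. B (2 ^ Suc k) \<le> B (2 ^ k)) sequentially"
    using large_digit_subexponential[OF assms]
  proof eventually_elim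
    case (elim k)
    then show ?case
      unfolding next_block using B0 C by (intro mult_left_le) (simp_all add: divide_le_eq)
  qed
  then obtain K where K: "\<And>k. B (2 ^ k) \<le> K"
    using bounded_if_eventually_decreasing[of "\<lambda>k. B (2 ^ k)"] by blast
  \<comment> \<open>The 1 accounts for the empty product \<open>B 0\<close>, which lies in no
    block.\<close>
  have "B n \<le> max 1 K" for n
  proof (cases "n = 0")
    case False
    have "B n = B (2 ^ floor_log n) / C ^ (n - 2 ^ floor_log n)"
      using floor_log_exp2_le[of n] floor_log_exp2_gt[of n] False by (intro block) auto
    also have "\<dots> \<le> B (2 ^ floor_log n) / 1"
      using B0 C by (intro divide_left_mono one_le_power) auto
    finally show ?thesis using K[of "floor_log n"] by simp
  qed (simp add: B_def)
  then show ?thesis unfolding B_def c_def by blast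
qed

section \<open>Asymptotics of the digit sums\<close>

lemma quotient_sum_cf_val:
  assumes "\<And>i. d i > 0"
  shows "quotient_sum n (cf_val d) = (\<Sum>i<n. d i)"
  unfolding quotient_sum_def
  by (induction n) (simp_all add: partial_quotient_cf_val[OF assms])

lemma sum_prescribed_le:
  assumes "n > 0"
  shows "(\<Sum>i<n. prescribed \<alpha> \<beta> i) \<le> (\<Sum>j\<le>floor_log n. large_digit \<alpha> \<beta> j)"
proof -
  let ?I = "(\<lambda>j. 2 ^ j - 1) ` {..floor_log n}"
  have inj: "inj_on (\<lambda>j. 2 ^ j - 1 :: nat) {..floor_log n}"
  proof (rule inj_onI)
    fix i j :: nat assume "2 ^ i - 1 = (2 ^ j - 1 :: nat)"
    then have "Suc (2 ^ i - 1) = Suc (2 ^ j - 1 :: nat)" by simp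
    then have "2 ^ i = (2 ^ j :: nat)" by simp
    then show "i = j" by simp
  qed
  have "(\<Sum>i<n. prescribed \<alpha> \<beta> i) = (\<Sum>i\<in>{i. i < n \<and> prescribed \<alpha> \<beta> i \<noteq> 0}. prescribed \<alpha> \<beta> i)"
    by (rule sum.mono_neutral_right) auto
  also have "\<dots> \<le> (\<Sum>i\<in>?I. prescribed \<alpha> \<beta> i)"
  proof (rule sum_mono2)
    show "{i. i < n \<and> prescribed \<alpha> \<beta> i \<noteq> 0} \<subseteq> ?I"
    proof
      fix i assume "i \<in> {i. i < n \<and> prescribed \<alpha> \<beta> i \<noteq> 0}"
      then have "Suc i = 2 ^ floor_log (Suc i)" "floor_log (Suc i) \<le> floor_log n"
        by (auto simp: prescribed_def floor_log_le_iff split: if_splits)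
      then show "i \<in> ?I" by (metis atMost_iff diff_Suc_1 image_eqI)
    qed
  qed auto
  also have "\<dots> = (\<Sum>j\<le>floor_log n. large_digit \<alpha> \<beta> j)"
    by (subst sum.reindex[OF inj]) (simp add: prescribed_power[unfolded One_nat_def])
  finally show ?thesis .
qed

text \<open>Consecutive block values of \<open>growth\<close> thus have ratio at least
  \<open>exp (2 * k + 1)\<close>, which makes all earlier prescribed digits together negligible
  against the last one.\<close>

lemma growth_exp_Suc_diff: "\<beta> \<ge> 0 \<Longrightarrow> growth_exp \<beta> k + 2 * real k + 1 \<le> growth_exp \<beta> (Suc k)"
  using powr_mono[of "real k * \<beta>" "real (Suc k) * \<beta>" 2]
  by (simp add: growth_exp_def power2_eq_square algebra_simps)

lemma quotient_sum_asymptotics: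
  assumes "\<alpha> > 0" "\<beta> \<ge> 0" and d: "\<And>i. d i \<in> digit_choices (prescribed \<alpha> \<beta>) M i"
  shows "(\<lambda>n. real (quotient_sum n (cf_val d)) / growth \<beta> n) \<longlonglongrightarrow> \<alpha>"
proof -
  have pos: "d i > 0" for i using d digit_choices_pos by blast
  have qs: "quotient_sum n (cf_val d) = (\<Sum>i<n. d i)" for n
    using pos by (rule quotient_sum_cf_val)
  \<comment> \<open>For \<open>floor_log n = Suc m\<close>, the first summand covers free digits and
    rounding, measured against \<open>exp ((Suc m)\<^sup>2)\<close>; the second covers the
    \<open>Suc m\<close> earlier prescribed digits by \<open>growth_exp_Suc_diff\<close>.\<close>
  define err where "err = (\<lambda>m::nat. (2 + real M * 2 ^ (m + 2) + 2 * real (Suc m)) * exp (- ((real (Suc m))\<^sup>2))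
    + real (Suc m) * \<alpha> * exp (- (2 * real m + 1)))"
  have err: "err \<longlonglongrightarrow> 0"
    unfolding err_def using assms(1) by real_asymp
  have lower: "\<alpha> \<le> real (quotient_sum n (cf_val d)) / growth \<beta> n" if "n > 0" for n
  proof -
    let ?i = "2 ^ floor_log n - 1 :: nat"
    have "?i < 2 ^ floor_log n" by simp
    then have "?i < n" using floor_log_exp2_le[OF that] by (rule less_le_trans)
    then have "d ?i \<le> (\<Sum>i<n. d i)"
      by (intro member_le_sum) auto
    moreover have "d ?i = large_digit \<alpha> \<beta> (floor_log n)"
      using d[of ?i] unfolding digit_choices_def prescribed_power by (simp add: large_digit_def)
    ultimately have "\<alpha> * growth \<beta> n \<le> real (\<Sum>i<n. d i)"
      using large_digit_bounds(1)[OF assms(1), of \<beta> "floor_log n"] unfolding growth_def by linarith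
    then show ?thesis using growth_pos[of \<beta> n] by (simp add: qs pos_le_divide_eq)
  qed
  have upper: "real (quotient_sum n (cf_val d)) / growth \<beta> n \<le> \<alpha> + err (floor_log n - 1)" if "n > 1" for n
  proof -
    have "floor_log n > 0" using that floor_log_le_iff[of 2 n] floor_log_power[of 1] by simp
    then obtain m where m: "floor_log n = Suc m" by (cases "floor_log n") auto
    define E where "E = exp (growth_exp \<beta> (Suc m))"
    define E' where "E' = exp (growth_exp \<beta> m)"
    have E: "E > 0" by (simp add: E_def)
    have "d i \<le> M + prescribed \<alpha> \<beta> i" for i
      using d[of i] by (auto simp: digit_choices_def split: if_splits)
    then have "(\<Sum>i<n. d i) \<le> (\<Sum>i<n. M + prescribed \<alpha> \<beta> i)"
      by (intro sum_mono)
    also have "\<dots> = n * M + (\<Sum>i<n. prescribed \<alpha> \<beta> i)"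
      by (simp add: sum.distrib)
    also have "\<dots> \<le> n * M + (\<Sum>j\<le>Suc m. large_digit \<alpha> \<beta> j)"
      using sum_prescribed_le[of n \<alpha> \<beta>] that m by simp
    also have "(\<Sum>j\<le>Suc m. large_digit \<alpha> \<beta> j) = (\<Sum>j\<le>m. large_digit \<alpha> \<beta> j) + large_digit \<alpha> \<beta> (Suc m)"
      by simp
    also have "(\<Sum>j\<le>m. large_digit \<alpha> \<beta> j) \<le> (\<Sum>j\<le>m. large_digit \<alpha> \<beta> m)"
      using assms by (intro sum_mono large_digit_mono) auto
    also have "\<dots> = Suc m * large_digit \<alpha> \<beta> m" by simp
    finally have "(\<Sum>i<n. d i) \<le> n * M + (Suc m * large_digit \<alpha> \<beta> m + large_digit \<alpha> \<beta> (Suc m))"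
      by simp
    then have "real (\<Sum>i<n. d i) \<le> real (n * M + (Suc m * large_digit \<alpha> \<beta> m + large_digit \<alpha> \<beta> (Suc m)))"
      by (simp only: of_nat_le_iff)
    also have "\<dots> = real n * real M + (real (Suc m) * real (large_digit \<alpha> \<beta> m) + real (large_digit \<alpha> \<beta> (Suc m)))"
      by (simp only: of_nat_add of_nat_mult)
    also have "\<dots> \<le> 2 ^ (m + 2) * real M + (real (Suc m) * (\<alpha> * E' + 2) + (\<alpha> * E + 2))"
    proof (intro add_mono mult_right_mono mult_left_mono)
      have "n \<le> 2 ^ (m + 2)" using floor_log_exp2_gt[of n] m by simp
      then have "real n \<le> real (2 ^ (m + 2))" by (simp only: of_nat_le_iff)
      then show "real n \<le> 2 ^ (m + 2)" by simp
    qed (use large_digit_bounds(2)[OF assms(1), of \<beta>] in \<open>auto simp: E_def E'_def\<close>)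
    also have "\<dots> = \<alpha> * E + ((2 + real M * 2 ^ (m + 2) + 2 * real (Suc m)) + real (Suc m) * \<alpha> * E')"
      by (simp add: algebra_simps)
    also have "\<dots> \<le> \<alpha> * E + err m * E"
    proof -
      have "exp ((real (Suc m))\<^sup>2) \<le> E"
        by (simp add: E_def growth_exp_def)
      then have "1 \<le> exp (- ((real (Suc m))\<^sup>2)) * E"
        by (simp add: exp_minus field_simps)
      then have "(2 + real M * 2 ^ (m + 2) + 2 * real (Suc m)) * 1
          \<le> (2 + real M * 2 ^ (m + 2) + 2 * real (Suc m)) * (exp (- ((real (Suc m))\<^sup>2)) * E)"
        by (intro mult_left_mono) auto
      moreover have "E' \<le> exp (- (2 * real m + 1)) * E"
        unfolding E_def E'_def exp_add[symmetric] using growth_exp_Suc_diff[OF assms(2), of m] by simp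
      then have "real (Suc m) * \<alpha> * E' \<le> real (Suc m) * \<alpha> * (exp (- (2 * real m + 1)) * E)"
        using assms by (intro mult_left_mono) auto
      ultimately show ?thesis
        unfolding err_def distrib_right by (simp only: mult.assoc mult_1_right)
    qed
    finally show ?thesis
      using E by (simp add: qs growth_def m E_def[symmetric] pos_divide_le_eq distrib_right)
  qed
  show ?thesis
  proof (rule tendsto_sandwich)
    show "eventually (\<lambda>n. \<alpha> \<le> real (quotient_sum n (cf_val d)) / growth \<beta> n) sequentially"
      using eventually_gt_at_top[of 0] by eventually_elim (rule lower)
    show "eventually (\<lambda>n. real (quotient_sum n (cf_val d)) / growth \<beta> n \<le> \<alpha> + err (floor_log n - 1)) sequentially"
      using eventually_gt_at_top[of 1] by eventually_elim (rule upper)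
    have "filterlim (\<lambda>n. floor_log n - 1) at_top sequentially"
      by (rule filterlim_compose[OF filterlim_minus_const_nat_at_top filterlim_floor_log])
    then have "(\<lambda>n. err (floor_log n - 1)) \<longlonglongrightarrow> 0"
      by (rule filterlim_compose[OF err])
    then show "(\<lambda>n. \<alpha> + err (floor_log n - 1)) \<longlonglongrightarrow> \<alpha>"
      using tendsto_add[OF tendsto_const[of \<alpha>]] by fastforce
  qed auto
qed

text \<open>\<open>M\<close> and \<open>C\<close> depend on \<open>s\<close>, but the prescribed
  digits do not; so each \<open>s < 1\<close> may use its own subset of the same
  \<open>E_set\<close>.\<close>

lemma hausdorff_dim_E_set_growth:
  assumes "\<alpha> > 0" "0 \<le> \<beta>" "\<beta> < 1"
  shows "hausdorff_dim (E_set (growth \<beta>) \<alpha>) = 1"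
proof -
  let ?E = "E_set (growth \<beta>) \<alpha>"
  have sub: "{cf_val d |d. \<forall>i. d i \<in> digit_choices (prescribed \<alpha> \<beta>) M i} \<subseteq> ?E" for M
  proof clarify
    fix d assume d: "\<forall>i. d i \<in> digit_choices (prescribed \<alpha> \<beta>) M i"
    then have pos: "d i > 0" for i using digit_choices_pos by blast
    show "cf_val d \<in> ?E"
      using quotient_sum_asymptotics[OF assms(1,2) d[rule_format]]
        cf_val_strict_bounds[of d, OF pos] cf_val_irrational[of d, OF pos]
      by (simp add: E_set_def)
  qed
  have "hausdorff_measure s ?E \<noteq> 0" if s: "0 < s" "s < 1" for s
  proof -
    obtain M C where MC: "M \<ge> 1" "C > 1" "2 powr (1 - s) * (1 - 2 / (real M + 1)) \<ge> C"
      using ex_gain[OF s(2)] by blast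
    obtain K where K: "\<forall>n. (\<Prod>i<n. if prescribed \<alpha> \<beta> i = 0 then 1 / C
        else (real (prescribed \<alpha> \<beta> i) + 1)\<^sup>2) \<le> K"
      using prescribed_cost_bounded[OF assms MC(2)] by (rule exE)
    have "hausdorff_measure s {cf_val d |d. \<forall>i. d i \<in> digit_choices (prescribed \<alpha> \<beta>) M i} \<noteq> 0"
      by (rule hausdorff_measure_digits_nonzero[OF s MC prescribed_neq_1 spec[OF K]])
    then show ?thesis
      using hausdorff_measure_mono[OF sub[of M], of s] by auto
  qed
  moreover have "?E \<noteq> {}"
  proof -
    \<comment> \<open>Any allowed sequence is a witness; here every free digit is 1.\<close>
    have "prescribed \<alpha> \<beta> i + (if prescribed \<alpha> \<beta> i = 0 then 1 else 0)
        \<in> digit_choices (prescribed \<alpha> \<beta>) 1 i" for i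
      by (simp add: digit_choices_def)
    then have "cf_val (\<lambda>i. prescribed \<alpha> \<beta> i + (if prescribed \<alpha> \<beta> i = 0 then 1 else 0)) \<in> ?E"
      by (intro subsetD[OF sub[of 1]]) blast
    then show ?thesis by blast
  qed
  ultimately have "hausdorff_dim ?E \<ge> 1" by (intro hausdorff_dim_ge_1)
  moreover have "hausdorff_dim ?E \<le> 1"
    by (rule hausdorff_dim_le_1) (auto simp: E_set_def)
  ultimately show ?thesis by (rule antisym[rotated])
qed

theorem theorem2:
  fixes \<alpha> \<beta> :: real
  assumes "\<alpha> > 0" and "0 \<le> \<beta>" and "\<beta> < 1"
  shows "\<exists>\<phi> :: nat \<Rightarrow> real.
           (\<forall>n\<ge>1. \<phi> n > 0) \<and> mono_on {1..} \<phi> \<and>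
           limsup (\<lambda>n. ereal (ln (ln (\<phi> n)) / ln (real n))) = ereal \<beta> \<and>
           hausdorff_dim (E_set \<phi> \<alpha>) = 1"
proof (intro exI conjI)
  show "\<forall>n\<ge>1. growth \<beta> n > 0" by (simp add: growth_pos)
  show "mono_on {1..} (growth \<beta>)" using growth_mono[OF assms(2)] by (auto intro: mono_onI)
  show "limsup (\<lambda>n. ereal (ln (ln (growth \<beta> n)) / ln (real n))) = ereal \<beta>"
    by (rule limsup_growth[OF assms(2)])
  show "hausdorff_dim (E_set (growth \<beta>) \<alpha>) = 1"
    by (rule hausdorff_dim_E_set_growth[OF assms])
qed

end
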